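(* Let $p\in\mathbb{N}$, let $\mathbf{a}=(a_1,\dots,a_p)$, $\mathbf{b}=(b_1,\dots,b_p)$ be complex vectors, $\psi_p=\sum_{i=1}^p(b_i-a_i)$, and let $g^k_p(n)$ be Nørlund's coefficients defined in the context. Then for each $k\in\{1,\dots,p\}$ and each $n\in\mathbb{N}_0$, $$g_p^k(n)=\sum_{r=0}^{n}\frac{(-1)^{n-r}(r+1)_{n-r}}{(n-r)!}\,\tilde{l}_r\,\mathcal{B}^{(n+1)}_{n-r}(2-a_k-\psi_p)=\sum_{r=0}^n\frac{(-1)^{n-r}(\psi_p+r)_{n-r}}{(n-r)!}\,l_r\,\mathcal{B}^{(n+\psi_p)}_{n-r}(1-a_k).$$ Here $\tilde l_0=1$ and, for $r\ge1$, $\tilde{l}_r=\frac{1}{r}\sum_{m=1}^r\tilde{q}_m\tilde{l}_{r-m}$, where $$\tilde{q}_m=\frac{(-1)^{m+1}}{m+1}\left[\mathcal{B}_{m+1}(a_k+\psi_p-1)-\mathcal{B}_{m+1}(a_k)+\sum_{j=1}^p\bigl(\mathcal{B}_{m+1}(a_j)-\mathcal{B}_{m+1}(b_j)\bigr)\right].$$ Similarly, $l_0=1$ and, for $r\ge1$, $l_r=\frac{1}{r}\sum_{m=1}^r q_m l_{r-m}$, where $$q_m=\frac{(-1)^{m+1}}{m+1}\sum_{j=1}^p\bigl(\mathcal{B}_{m+1}(a_j)-\mathcal{B}_{m+1}(b_j)\bigr).$$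
   Context: Notation: $(x)_n=x(x+1)\cdots(x+n-1)$, $(x)_0=1$, is the rising factorial; $\mathbb{N}_0=\{0,1,2,\dots\}$; $\psi_m=\sum_{i=1}^m(b_i-a_i)$. The generalized Bernoulli (Bernoulli–Nørlund) polynomials $\mathcal{B}^{(\sigma)}_k(x)$, $\sigma\in\mathbb{C}$, are defined by $\dfrac{t^{\sigma}e^{xt}}{(e^t-1)^{\sigma}}=\sum_{k=0}^{\infty}\mathcal{B}^{(\sigma)}_{k}(x)\dfrac{t^k}{k!}$ (with $(t/(e^t-1))^\sigma$ equal to $1$ at $t=0$), and $\mathcal{B}_k(x)=\mathcal{B}^{(1)}_k(x)$ is the classical Bernoulli polynomial. Meijer's function $G^{p,0}_{p,p}$: for $0<z<1$, $$G^{p,0}_{p,p}\left(z\,\Big|\,{\mathbf{b}\atop\mathbf{a}}\right)=\frac{1}{2\pi i}\int_{\mathcal{L}_-}\frac{\Gamma(a_1+s)\cdots\Gamma(a_p+s)}{\Gamma(b_1+s)\cdots\Gamma(b_p+s)}z^{-s}\,ds,$$ where $\mathcal{L}_-$ is a left loop lying in a horizontal strip, starting at $-\infty+i\varphi_1$, ending at $-\infty+i\varphi_2$ ($\varphi_1<\varphi_2$), and having all poles of the integrand on its left. Nørlund's coefficients $g^k_p(n)$, $k\in\{1,\dots,p\}$, $n\in\mathbb{N}_0$, are defined (for $-\psi_p\notin\mathbb{N}_0$) by the expansion, for $0<z<1$, $$G^{p,0}_{p,p}\left(z\,\Big|\,{\mathbf{b}\atop\mathbf{a}}\right)=\frac{z^{a_k}(1-z)^{\psi_p-1}}{\Gamma(\psi_p)}\sum_{n=0}^{\infty}\frac{g_p^k(n)}{(\psi_p)_n}(1-z)^n.$$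 They are polynomials in the components of $\mathbf{a}$ and $\mathbf{b}$ (which defines them for all complex parameters). By a known formula of Nørlund they are given explicitly by $$g^{p}_{p}(n)=\sum_{0\le j_1\le j_2\le\cdots\le j_{p-2}\le n}\ \prod_{m=1}^{p-1}\frac{(\psi_m+j_{m-1})_{j_m-j_{m-1}}}{(j_m-j_{m-1})!}(b_{m+1}-a_m)_{j_m-j_{m-1}},\qquad j_0=0,\ j_{p-1}=n,$$ (for $p=1$: $g^1_1(0)=1$ and $g^1_1(n)=0$ for $n\ge1$), and $g^k_p(n)$ is obtained from $g^p_p(n)$ by exchanging the roles of $a_p$ and $a_k$. *)

theory Defs
  imports "HOL-Complex_Analysis.Complex_Analysis"
begin

(* Parameter vectors are functions nat => complex; only the entries with index in {1..p} are used. *)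

definition psi :: "(nat \<Rightarrow> complex) \<Rightarrow> (nat \<Rightarrow> complex) \<Rightarrow> nat \<Rightarrow> complex" where
  "psi a b m = (\<Sum>i=1..m. b i - a i)"

(* The generating function t^\<sigma> e^(xt) / (e^t - 1)^\<sigma> as a formal power series.  The constant
   term of t / (e^t - 1) is 1, and (1 + u)^\<sigma> is the binomial series, so the \<sigma>-th power is the
   branch with value 1 at t = 0. *)
definition gen_bernoulli_fps :: "complex \<Rightarrow> complex \<Rightarrow> complex fps" where
  "gen_bernoulli_fps \<sigma> x =
     fps_compose (fps_binomial \<sigma>) (fps_X / (fps_exp 1 - 1) - 1) * fps_exp x"

definition gen_bernoulli :: "complex \<Rightarrow> nat \<Rightarrow> complex \<Rightarrow> complex" where
  "gen_bernoulli \<sigma> k x = fact k * fps_nth (gen_bernoulli_fps \<sigma> x) k"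

abbreviation bernoulli_poly :: "nat \<Rightarrow> complex \<Rightarrow> complex" where
  "bernoulli_poly k x \<equiv> gen_bernoulli 1 k x"

(* gen_bernoulli agrees with the analytic definition: near 0 the values t / (e^t - 1) are close
   to 1, where powr is the principal power. *)
lemma gen_bernoulli_generating_function:
  "(\<lambda>t. (if t = 0 then 1 else t / (exp t - 1)) powr \<sigma> * exp (x * t))
     has_fps_expansion Abs_fps (\<lambda>k. gen_bernoulli \<sigma> k x / fact k)"
proof -
  have sd: "subdegree (fps_exp 1 - 1 :: complex fps) = 1"
    by (rule subdegreeI) auto
  have 1: "(\<lambda>t. if t = 0 then 1 else t / (exp t - 1 :: complex))
          has_fps_expansion (fps_X / (fps_exp 1 - 1))"
  proof -
    have E: "(\<lambda>t. exp t - 1 :: complex) has_fps_expansion (fps_exp 1 - 1)"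
      using has_fps_expansion_diff[OF has_fps_expansion_exp[of 1] has_fps_expansion_1] by simp
    have X: "(\<lambda>t. t :: complex) has_fps_expansion fps_X"
      by (intro fps_expansion_intros)
    have nz: "(fps_exp 1 - 1 :: complex fps) \<noteq> 0" using sd by auto
    show ?thesis
      using has_fps_expansion_divide[OF X E, of 1] sd nz by (simp cong: if_cong)
  qed
  have c0: "fps_nth (fps_X / (fps_exp 1 - 1) :: complex fps) 0 = 1"
    using has_fps_expansion_imp_0_eq_fps_nth_0[OF 1] by simp
  have 2: "((\<lambda>u. (1 + u) powr \<sigma>) \<circ> (\<lambda>t. (if t = 0 then 1 else t / (exp t - 1)) - 1))
          has_fps_expansion (fps_compose (fps_binomial \<sigma>) (fps_X / (fps_exp 1 - 1) - 1))"
    using c0 by (intro has_fps_expansion_compose has_fps_expansion_diff 1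
      has_fps_expansion_binomial_complex has_fps_expansion_1) auto
  have 3: "(\<lambda>t. exp (x * t)) has_fps_expansion fps_exp x"
    by (intro fps_expansion_intros)
  have eq: "Abs_fps (\<lambda>k. gen_bernoulli \<sigma> k x / fact k) = gen_bernoulli_fps \<sigma> x"
    by (rule fps_ext) (simp add: gen_bernoulli_def)
  show ?thesis
    using has_fps_expansion_mult[OF 2 3] unfolding eq gen_bernoulli_fps_def o_def by simp
qed

definition meijer_integrand ::
    "nat \<Rightarrow> (nat \<Rightarrow> complex) \<Rightarrow> (nat \<Rightarrow> complex) \<Rightarrow> real \<Rightarrow> complex \<Rightarrow> complex" where
  "meijer_integrand p a b z s =
     (\<Prod>i=1..p. Gamma (a i + s)) / (\<Prod>i=1..p. Gamma (b i + s)) * of_real z powr (- s)"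

(* Gamma is 0 at its poles by convention, so x / Gamma w = 0 there, which is the value
   of x * (1 / Gamma) as an entire function. *)
lemma divide_Gamma_eq: "x / Gamma w = x * rGamma (w :: complex)"
  by (simp add: rGamma_inverse_Gamma divide_inverse)

(* The left loop runs from -oo + i\<phi>1 along a horizontal ray to c + i\<phi>1, vertically up to
   c + i\<phi>2, and back along a horizontal ray to -oo + i\<phi>2.  It has all the points -a_i - l
   (l a natural number), i.e. all poles of the Gamma functions in the numerator, on its left. *)
definition left_loop :: "nat \<Rightarrow> (nat \<Rightarrow> complex) \<Rightarrow> real \<Rightarrow> real \<Rightarrow> real \<Rightarrow> bool" where
  "left_loop p a c \<phi>1 \<phi>2 \<longleftrightarrow> \<phi>1 < \<phi>2 \<and>
     (\<forall>i\<in>{1..p}. \<forall>l::nat. Re (- a i - of_nat l) < c \<and>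
        \<phi>1 < Im (- a i - of_nat l) \<and> Im (- a i - of_nat l) < \<phi>2)"

definition left_loop_integral :: "real \<Rightarrow> real \<Rightarrow> real \<Rightarrow> (complex \<Rightarrow> complex) \<Rightarrow> complex" where
  "left_loop_integral c \<phi>1 \<phi>2 f =
     integral {..c} (\<lambda>x. f (Complex x \<phi>1))
     + contour_integral (linepath (Complex c \<phi>1) (Complex c \<phi>2)) f
     - integral {..c} (\<lambda>x. f (Complex x \<phi>2))"

(* For 0 < z < 1 the integral does not depend on the loop, by Cauchy's theorem. *)
definition meijer_G :: "nat \<Rightarrow> (nat \<Rightarrow> complex) \<Rightarrow> (nat \<Rightarrow> complex) \<Rightarrow> real \<Rightarrow> complex" where
  "meijer_G p a b z = (THE w. \<forall>c \<phi>1 \<phi>2. left_loop p a c \<phi>1 \<phi>2 \<longrightarrow>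
     w = 1 / (2 * of_real pi * \<i>) * left_loop_integral c \<phi>1 \<phi>2 (meijer_integrand p a b z))"

(* Polynomial functions of a_1, ..., a_p, b_1, ..., b_p with complex coefficients. *)
inductive param_polynomial ::
    "nat \<Rightarrow> ((nat \<Rightarrow> complex) \<Rightarrow> (nat \<Rightarrow> complex) \<Rightarrow> complex) \<Rightarrow> bool" for p where
  const: "param_polynomial p (\<lambda>a b. c)"
| var_a: "i \<in> {1..p} \<Longrightarrow> param_polynomial p (\<lambda>a b. a i)"
| var_b: "i \<in> {1..p} \<Longrightarrow> param_polynomial p (\<lambda>a b. b i)"
| add: "param_polynomial p f \<Longrightarrow> param_polynomial p g \<Longrightarrow> param_polynomial p (\<lambda>a b. f a b + g a b)"
| mult: "param_polynomial p f \<Longrightarrow> param_polynomial p g \<Longrightarrow> param_polynomial p (\<lambda>a b. f a b * g a b)"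

(* g k n a b is Noerlund's coefficient g^k_p(n) for the parameters a, b.  The expansion
   determines it when -psi_p is not a natural number; being polynomial in the parameters
   determines it for all of them. *)
definition norlund_coefficients ::
    "nat \<Rightarrow> (nat \<Rightarrow> nat \<Rightarrow> (nat \<Rightarrow> complex) \<Rightarrow> (nat \<Rightarrow> complex) \<Rightarrow> complex) \<Rightarrow> bool" where
  "norlund_coefficients p g \<longleftrightarrow>
     (\<forall>k\<in>{1..p}. \<forall>n. param_polynomial p (g k n)) \<and>
     (\<forall>a b. - psi a b p \<notin> \<nat> \<longrightarrow>
        (\<forall>k\<in>{1..p}. \<forall>z\<in>{0<..<1::real}.
           (\<lambda>n. of_real z powr (a k) * of_real (1 - z) powr (psi a b p - 1) / Gamma (psi a b p) *
                (g k n a b / pochhammer (psi a b p) n * of_real (1 - z) ^ n))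
             sums meijer_G p a b z))"

function exp_rec :: "(nat \<Rightarrow> complex) \<Rightarrow> nat \<Rightarrow> complex" where
  "exp_rec q r = (if r = 0 then 1 else 1 / of_nat r * (\<Sum>m=1..r. q m * exp_rec q (r - m)))"
  by auto
termination by (relation "Wellfounded.measure snd") auto

declare exp_rec.simps [simp del]

definition norlund_q :: "nat \<Rightarrow> (nat \<Rightarrow> complex) \<Rightarrow> (nat \<Rightarrow> complex) \<Rightarrow> nat \<Rightarrow> complex" where
  "norlund_q p a b m = (-1) ^ (m + 1) / of_nat (m + 1) *
     (\<Sum>j=1..p. bernoulli_poly (m + 1) (a j) - bernoulli_poly (m + 1) (b j))"

definition norlund_q_tilde ::
    "nat \<Rightarrow> (nat \<Rightarrow> complex) \<Rightarrow> (nat \<Rightarrow> complex) \<Rightarrow> nat \<Rightarrow> nat \<Rightarrow> complex" where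
  "norlund_q_tilde p a b k m = (-1) ^ (m + 1) / of_nat (m + 1) *
     (bernoulli_poly (m + 1) (a k + psi a b p - 1) - bernoulli_poly (m + 1) (a k) +
      (\<Sum>j=1..p. bernoulli_poly (m + 1) (a j) - bernoulli_poly (m + 1) (b j)))"

definition norlund_l :: "nat \<Rightarrow> (nat \<Rightarrow> complex) \<Rightarrow> (nat \<Rightarrow> complex) \<Rightarrow> nat \<Rightarrow> complex" where
  "norlund_l p a b = exp_rec (norlund_q p a b)"

definition norlund_l_tilde ::
    "nat \<Rightarrow> (nat \<Rightarrow> complex) \<Rightarrow> (nat \<Rightarrow> complex) \<Rightarrow> nat \<Rightarrow> nat \<Rightarrow> complex" where
  "norlund_l_tilde p a b k = exp_rec (norlund_q_tilde p a b k)"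

end

theory Submission
  imports Defs
begin

text \<open>
  Both sides are polynomials in the parameters, so it suffices to treat $b_i = a_i + m_i$ with
  integers $m_i \ge 2$ and pairwise incongruent $a_i$ modulo the integers. There the quotient of
  Gamma functions is $1/\prod_\alpha (s+\alpha)$, where $\alpha$ runs over the $M = \psi_p$ distinct
  numbers $a_i + l$, $0 \le l < m_i$. By partial fractions $G(z) = \sum_\alpha c_\alpha z^\alpha$ with
  $c_\alpha = \prod_{\beta\neq\alpha} (\beta-\alpha)^{-1}$, and expanding $z^{\alpha-a_k}$ in powers of
  $1-z$ gives
  $$g^k_p(n) = \sum_\alpha c_\alpha \, (a_k-\alpha)_{M-1+n}.$$
  The second formula follows from $\mathcal{B}^{(N+1)}_N(x) = (x-1)\cdots(x-N)$, the addition theorem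
  in $x$, and $\sum_\alpha c_\alpha (-\alpha)^{M-1+r} = l_r$, the coefficient of $x^r$ in
  $\prod_\alpha (1+\alpha x)^{-1}$, since $q_m$ is the power sum $\sum_\alpha (-\alpha)^m$.

  The same expression shows that replacing $a_k$ by $a_k+1$ does not change $g^k_p(n)$: the term
  $\alpha = a_k$ vanishes and in the others one factor $a_k-\alpha$ cancels. Hence $g^k_p(n)$ does not
  depend on $a_k$ at all, and the first formula is the second one with $a_k$ replaced by
  $a_k+\psi_p-1$.
\<close>

subsection \<open>Loop integrals of simple poles\<close>

lemma integrable_on_exp_to_minus_infinity:
  fixes d c :: real
  assumes "d > 0"
  shows "(\<lambda>x. exp (d * x)) integrable_on {..c}"
proof -
  have "(\<lambda>x. exp (- d * x)) absolutely_integrable_on {-c..}"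
    by (intro nonnegative_absolutely_integrable_1 integrable_on_exp_minus_to_infinity assms) auto
  then have "(\<lambda>x. exp (d * (- x))) absolutely_integrable_on {-c..}"
    by simp
  then have "(\<lambda>x. exp (d * x)) absolutely_integrable_on {..c}"
    using has_absolute_integral_reflect_real[of "{-c..}" "{..c}" "\<lambda>x. exp (d * x)"
        "integral {-c..} (\<lambda>x. exp (d * (- x)))"] by auto
  then show ?thesis
    using set_lebesgue_integral_eq_integral(1) by blast
qed

text \<open>Dominated convergence for the truncations of f to \<open>{- real n..c}\<close>. It
  recovers the horizontal rays of a loop as limits of the horizontal sides of growing
  rectangles.\<close>

lemma integral_atMost_dominated:
  fixes f :: "real \<Rightarrow> complex"
  assumes f: "continuous_on UNIV f" and h: "h integrable_on {..c}"
    and le: "\<And>x. x \<le> c \<Longrightarrow> norm (f x) \<le> h x"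
  shows "f integrable_on {..c}"
    and "(\<lambda>n. integral {- real n..c} f) \<longlonglongrightarrow> integral {..c} f"
proof -
  have f': "(\<lambda>x. if x \<in> {- real n..c} then f x else 0) integrable_on {..c}" for n
  proof -
    have "f integrable_on {- real n..c}"
      by (intro integrable_continuous_interval continuous_on_subset[OF f]) auto
    then have "f integrable_on {- real n..c} \<inter> {..c}"
      by (simp add: Int_absorb2)
    then show ?thesis
      by (subst integrable_restrict_Int) (simp add: Int_commute)
  qed
  have le': "norm (if x \<in> {- real n..c} then f x else 0) \<le> h x" if "x \<in> {..c}" for n x
    using le[of x] that order_trans[OF norm_ge_zero le[of x]] by auto
  have lim: "(\<lambda>n. if x \<in> {- real n..c} then f x else 0) \<longlonglongrightarrow> f x" if "x \<in> {..c}" for x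
  proof (rule tendsto_eventually)
    have "eventually (\<lambda>n. real n \<ge> - x) at_top"
      by (meson eventually_sequentiallyI nat_ceiling_le_eq)
    then show "eventually (\<lambda>n. (if x \<in> {- real n..c} then f x else 0) = f x) at_top"
      by eventually_elim (use that in auto)
  qed
  show "f integrable_on {..c}"
    by (rule dominated_convergence(1)[OF f' h le' lim])
  have "(\<lambda>n. integral {..c} (\<lambda>x. if x \<in> {- real n..c} then f x else 0)) \<longlonglongrightarrow> integral {..c} f"
    by (rule dominated_convergence(2)[OF f' h le' lim])
  moreover have "integral {..c} (\<lambda>x. if x \<in> {- real n..c} then f x else 0) = integral {- real n..c} f"
    for n
    by (subst integral_restrict_Int) (simp add: Int_absorb2 Int_commute)
  ultimately show "(\<lambda>n. integral {- real n..c} f) \<longlonglongrightarrow> integral {..c} f"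
    by simp
qed

lemma has_contour_integral_linepath_horizontal:
  assumes "u < v" and f: "continuous_on UNIV (\<lambda>x. f (Complex x y))"
  shows "(f has_contour_integral integral {u..v} (\<lambda>x. f (Complex x y)))
           (linepath (Complex u y) (Complex v y))"
proof -
  have "((\<lambda>x. f (Complex x y)) has_integral integral {u..v} (\<lambda>x. f (Complex x y))) {u..v}"
    by (intro integrable_integral integrable_continuous_interval continuous_on_subset[OF f]) auto
  \<comment> \<open>The real-segment criterion applies after moving the segment down to the real
    axis; \<open>Re\<close> discards the height, so both parametrizations over \<open>{0..1}\<close>
    give the same integrand.\<close>
  then have "((\<lambda>x. f (Complex (Re x) y)) has_contour_integral integral {u..v} (\<lambda>x. f (Complex x y)))
      (linepath (of_real u) (of_real v))"
    using assms(1) by (subst has_contour_integral_linepath_Reals_iff) auto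
  then have "((\<lambda>t. f (Complex (Re (linepath (of_real u) (of_real v) t)) y) * (of_real v - of_real u))
      has_integral integral {u..v} (\<lambda>x. f (Complex x y))) {0..1}"
    by (simp add: has_contour_integral_linepath)
  also have "(\<lambda>t. f (Complex (Re (linepath (of_real u) (of_real v) t)) y) * (of_real v - of_real u)) =
      (\<lambda>t. f (linepath (Complex u y) (Complex v y) t) * (Complex v y - Complex u y))"
    by (rule ext, intro arg_cong2[of _ _ _ _ "(*)"] arg_cong[of _ _ f])
       (auto simp: linepath_def complex_eq_iff algebra_simps)
  finally show ?thesis
    by (simp add: has_contour_integral_linepath)
qed

section \<open>The loop integral of z^(-s) / (s - w), by residues\<close>

definition pole_term :: "real \<Rightarrow> complex \<Rightarrow> complex \<Rightarrow> complex" where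
  "pole_term z w s = of_real z powr (- s) / (s - w)"

context
  fixes z c y1 y2 :: real and w :: complex
  assumes z: "0 < z" "z < 1"
begin

text \<open>The modulus of z^(-s) is z^(- Re s), which decays as Re s goes to minus infinity because
  0 < z < 1. This bounds both the rays and the far vertical side.\<close>

lemma norm_pole_term_le:
  assumes "\<delta> > 0" "\<delta> \<le> norm (s - w)"
  shows "norm (pole_term z w s) \<le> exp (- ln z * Re s) / \<delta>"
proof -
  have "norm (pole_term z w s) = exp (- ln z * Re s) / norm (s - w)"
    using z by (simp add: pole_term_def norm_divide norm_powr_real_powr powr_def mult.commute)
  then show ?thesis
    using assms by (simp add: frac_le)
qed

lemma continuous_pole_term_horizontal:
  assumes "y \<noteq> Im w"
  shows "continuous_on UNIV (\<lambda>x. pole_term z w (Complex x y))"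
proof -
  have "continuous_on UNIV (\<lambda>x. Complex x y)"
    by (simp add: Complex_eq) (intro continuous_intros)
  moreover have "Complex x y \<noteq> w" for x
    using assms by auto
  ultimately show ?thesis
    using z unfolding pole_term_def by (intro continuous_intros) auto
qed

lemma norm_pole_term_horizontal:
  assumes "y \<noteq> Im w"
  shows "norm (pole_term z w (Complex x y)) \<le> exp (- ln z * x) / \<bar>y - Im w\<bar>"
  using norm_pole_term_le[of "\<bar>y - Im w\<bar>" "Complex x y"] assms abs_Im_le_cmod[of "Complex x y - w"]
  by simp

lemma integral_pole_term_horizontal:
  assumes "y \<noteq> Im w"
  shows "(\<lambda>x. pole_term z w (Complex x y)) integrable_on {..c}"
    and "(\<lambda>n. integral {- real n..c} (\<lambda>x. pole_term z w (Complex x y)))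
           \<longlonglongrightarrow> integral {..c} (\<lambda>x. pole_term z w (Complex x y))"
proof -
  have "(\<lambda>x. exp (- ln z * x) / \<bar>y - Im w\<bar>) integrable_on {..c}"
    using z by (intro integrable_on_divide integrable_on_exp_to_minus_infinity) auto
  from integral_atMost_dominated[OF continuous_pole_term_horizontal[OF assms] this
        norm_pole_term_horizontal[OF assms]]
  show "(\<lambda>x. pole_term z w (Complex x y)) integrable_on {..c}"
    and "(\<lambda>n. integral {- real n..c} (\<lambda>x. pole_term z w (Complex x y)))
           \<longlonglongrightarrow> integral {..c} (\<lambda>x. pole_term z w (Complex x y))"
    by auto
qed

lemma contour_integrable_pole_term:
  assumes "Re w \<noteq> u"
  shows "pole_term z w contour_integrable_on linepath (Complex u y1) (Complex u y2)"
proof (rule contour_integrable_continuous_linepath)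
  have "s \<noteq> w" if "s \<in> closed_segment (Complex u y1) (Complex u y2)" for s
    using assms that by (auto simp: closed_segment_same_Re)
  then show "continuous_on (closed_segment (Complex u y1) (Complex u y2)) (pole_term z w)"
    using z unfolding pole_term_def by (intro continuous_intros) auto
qed

text \<open>Close the loop by a vertical side at Re s = u and apply Cauchy's formula to the
  rectangle. As u = -n goes to minus infinity, the horizontal sides tend to the rays and the closing
  side contributes O(z^n).\<close>

lemma left_loop_integral_pole_term:
  assumes w: "Re w < c" "y1 < Im w" "Im w < y2"
  shows "left_loop_integral c y1 y2 (pole_term z w) = 2 * of_real pi * \<i> * of_real z powr (- w)"
proof -
  define V where "V u = contour_integral (linepath (Complex u y1) (Complex u y2)) (pole_term z w)" for u
  define H where "H y u = integral {u..c} (\<lambda>x. pole_term z w (Complex x y))" for y u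
  have rect: "H y1 u + V c - H y2 u - V u = 2 * of_real pi * \<i> * of_real z powr (- w)"
    if u: "u < Re w" for u
  proof -
    have 1: "(pole_term z w has_contour_integral H y1 u) (linepath (Complex u y1) (Complex c y1))"
      unfolding H_def using u w
      by (intro has_contour_integral_linepath_horizontal continuous_pole_term_horizontal) auto
    have 2: "(pole_term z w has_contour_integral V c) (linepath (Complex c y1) (Complex c y2))"
      unfolding V_def using u w
      by (intro has_contour_integral_integral contour_integrable_pole_term) auto
    have "(pole_term z w has_contour_integral H y2 u) (linepath (Complex u y2) (Complex c y2))"
      unfolding H_def using u w
      by (intro has_contour_integral_linepath_horizontal continuous_pole_term_horizontal) auto
    then have 3: "(pole_term z w has_contour_integral - H y2 u) (linepath (Complex c y2) (Complex u y2))"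
      using has_contour_integral_reverse_linepath by blast
    have "(pole_term z w has_contour_integral V u) (linepath (Complex u y1) (Complex u y2))"
      unfolding V_def using u w
      by (intro has_contour_integral_integral contour_integrable_pole_term) auto
    then have 4: "(pole_term z w has_contour_integral - V u) (linepath (Complex u y2) (Complex u y1))"
      using has_contour_integral_reverse_linepath by blast
    have boundary: "(pole_term z w has_contour_integral (H y1 u + (V c + (- H y2 u + - V u))))
        (rectpath (Complex u y1) (Complex c y2))"
      unfolding rectpath_def Let_def
      by (simp only: complex.sel, intro has_contour_integral_join 1 2 3 4) (auto simp: valid_path_join)
    have "((\<lambda>s. of_real z powr (- s) / (s - w)) has_contour_integral
        of_real (2 * pi) * \<i> * winding_number (rectpath (Complex u y1) (Complex c y2)) w
          * of_real z powr (- w)) (rectpath (Complex u y1) (Complex c y2))"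
    proof (rule Cauchy_integral_formula_convex_simple[where S = UNIV])
      show "(\<lambda>s. of_real z powr (- s)) holomorphic_on UNIV"
        using z by (intro holomorphic_intros) auto
      show "path_image (rectpath (Complex u y1) (Complex c y2)) \<subseteq> UNIV - {w}"
        using u w by (auto simp: path_image_rectpath_cbox_minus_box in_box_complex_iff)
    qed auto
    moreover have "winding_number (rectpath (Complex u y1) (Complex c y2)) w = 1"
      using u w by (intro winding_number_rectpath) (auto simp: in_box_complex_iff)
    ultimately have "(pole_term z w has_contour_integral 2 * of_real pi * \<i> * of_real z powr (- w))
        (rectpath (Complex u y1) (Complex c y2))"
      by (simp add: pole_term_def[abs_def])
    with boundary show ?thesis
      using has_contour_integral_unique by fastforce
  qed
  have "(\<lambda>n. V (- real n)) \<longlonglongrightarrow> 0"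
  proof (rule Lim_null_comparison)
    show "\<forall>\<^sub>F n in sequentially. norm (V (- real n)) \<le> exp (ln z * real n) * \<bar>y2 - y1\<bar>"
    proof -
      \<comment> \<open>From here on the closing side has distance at least 1 from w, so the pole
        bound applies with \<delta> = 1.\<close>
      have "\<forall>\<^sub>F n in sequentially. real n \<ge> 1 - Re w"
        by (meson eventually_sequentiallyI nat_ceiling_le_eq)
      then show ?thesis
      proof eventually_elim
        case (elim n)
        have bound: "norm (pole_term z w s) \<le> exp (ln z * real n)"
          if "s \<in> closed_segment (Complex (- real n) y1) (Complex (- real n) y2)" for s
        proof -
          have "Re s = - real n"
            using that by (auto simp: closed_segment_same_Re)
          then show ?thesis
            using norm_pole_term_le[of 1 s] elim abs_Re_le_cmod[of "s - w"] by simp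
        qed
        have "pole_term z w contour_integrable_on
            linepath (Complex (- real n) y1) (Complex (- real n) y2)"
          using elim by (intro contour_integrable_pole_term) auto
        then have "norm (V (- real n)) \<le> exp (ln z * real n) *
            norm (Complex (- real n) y2 - Complex (- real n) y1)"
          unfolding V_def by (intro contour_integral_bound_linepath bound) auto
        then show ?case
          by (simp add: cmod_def)
      qed
    qed
    have "(\<lambda>n. exp (ln z * real n)) = (\<lambda>n. z ^ n)"
      using z by (simp add: mult.commute[of "ln z"] exp_of_nat_mult)
    then show "(\<lambda>n. exp (ln z * real n) * \<bar>y2 - y1\<bar>) \<longlonglongrightarrow> 0"
      using z by (auto intro!: tendsto_mult_left_zero LIMSEQ_power_zero)
  qed
  then have "(\<lambda>n. H y1 (- real n) + V c - H y2 (- real n) - V (- real n)) \<longlonglongrightarrow>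
      integral {..c} (\<lambda>x. pole_term z w (Complex x y1)) + V c
        - integral {..c} (\<lambda>x. pole_term z w (Complex x y2)) - 0"
    unfolding H_def using w by (intro tendsto_intros integral_pole_term_horizontal) auto
  moreover have "\<forall>\<^sub>F n in sequentially. H y1 (- real n) + V c - H y2 (- real n) - V (- real n)
      = 2 * of_real pi * \<i> * of_real z powr (- w)"
  proof -
    have "\<forall>\<^sub>F n in sequentially. real n \<ge> 1 - Re w"
      by (meson eventually_sequentiallyI nat_ceiling_le_eq)
    then show ?thesis
      by eventually_elim (intro rect, auto)
  qed
  ultimately have "integral {..c} (\<lambda>x. pole_term z w (Complex x y1)) + V c
        - integral {..c} (\<lambda>x. pole_term z w (Complex x y2)) - 0 = 2 * of_real pi * \<i> * of_real z powr (- w)"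
    by (rule LIMSEQ_unique[OF _ tendsto_eventually])
  then show ?thesis
    by (simp add: left_loop_integral_def V_def)
qed

end

subsection \<open>Partial fractions and power sums\<close>

text \<open>The residue of \<open>1 / (\<Prod>\<beta>\<in>A. s + \<beta>)\<close> at s = -\<alpha>,
  for \<alpha> in a finite set A.\<close>

definition pf_coeff :: "complex set \<Rightarrow> complex \<Rightarrow> complex" where
  "pf_coeff A \<alpha> = inverse (\<Prod>\<beta>\<in>A - {\<alpha>}. \<beta> - \<alpha>)"

lemma pf_coeff_insert:
  assumes "finite A" "\<gamma> \<notin> A" "\<alpha> \<in> A"
  shows "pf_coeff (insert \<gamma> A) \<alpha> = pf_coeff A \<alpha> / (\<gamma> - \<alpha>)"
proof -
  have "insert \<gamma> A - {\<alpha>} = insert \<gamma> (A - {\<alpha>})"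
    using assms by auto
  then show ?thesis
    using assms by (simp add: pf_coeff_def divide_simps)
qed

text \<open>Induction on A with s arbitrary: the coefficient of the new element \<gamma> is the
  induction hypothesis evaluated at s = -\<gamma>, and then the identity holds summand by
  summand.\<close>

lemma partial_fractions:
  assumes "finite A" "A \<noteq> {}" "\<And>\<alpha>. \<alpha> \<in> A \<Longrightarrow> s + \<alpha> \<noteq> 0"
  shows "(\<Sum>\<alpha>\<in>A. pf_coeff A \<alpha> / (s + \<alpha>)) = inverse (\<Prod>\<alpha>\<in>A. s + \<alpha>)"
  using assms
proof (induction A arbitrary: s rule: finite_ne_induct)
  case (singleton x)
  then show ?case by (simp add: pf_coeff_def divide_inverse)
next
  case (insert \<gamma> A)
  have pg: "pf_coeff (insert \<gamma> A) \<gamma> = (\<Sum>\<alpha>\<in>A. pf_coeff A \<alpha> / (\<alpha> - \<gamma>))"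
  proof -
    have "\<alpha> - \<gamma> \<noteq> 0" if "\<alpha> \<in> A" for \<alpha>
      using insert.hyps that by auto
    then show ?thesis
      using insert.IH[of "- \<gamma>"] insert.hyps by (simp add: pf_coeff_def)
  qed
  have nz: "s + \<gamma> \<noteq> 0" using insert.prems by auto
  have "(\<Sum>\<alpha>\<in>insert \<gamma> A. pf_coeff (insert \<gamma> A) \<alpha> / (s + \<alpha>)) =
      (\<Sum>\<alpha>\<in>A. pf_coeff A \<alpha> / (\<alpha> - \<gamma>) / (s + \<gamma>) + pf_coeff A \<alpha> / (\<gamma> - \<alpha>) / (s + \<alpha>))"
    using insert.hyps
    by (simp add: pg pf_coeff_insert sum.distrib sum_divide_distrib)
  also have "\<dots> = (\<Sum>\<alpha>\<in>A. pf_coeff A \<alpha> / (s + \<alpha>) / (s + \<gamma>))"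
  proof (rule sum.cong[OF refl])
    fix \<alpha> assume "\<alpha> \<in> A"
    then have "\<alpha> - \<gamma> \<noteq> 0" "\<gamma> - \<alpha> \<noteq> 0" "s + \<alpha> \<noteq> 0"
      using insert by auto
    then show "pf_coeff A \<alpha> / (\<alpha> - \<gamma>) / (s + \<gamma>) + pf_coeff A \<alpha> / (\<gamma> - \<alpha>) / (s + \<alpha>) =
        pf_coeff A \<alpha> / (s + \<alpha>) / (s + \<gamma>)"
      using nz by (simp add: divide_simps) (simp add: algebra_simps)
  qed
  also have "\<dots> = inverse (\<Prod>\<alpha>\<in>A. s + \<alpha>) / (s + \<gamma>)"
    using insert.IH[of s] insert.prems by (simp flip: sum_divide_distrib del: divide_divide_eq_left)
  finally show ?case
    using insert.hyps by (simp add: divide_inverse)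
qed

text \<open>In the variable \<open>x = 1 / s\<close> the fraction \<open>1 / (s + \<alpha>)\<close> becomes \<open>x\<close> times the following series.\<close>

definition geom_fps :: "complex \<Rightarrow> complex fps" where
  "geom_fps \<alpha> = inverse (1 + fps_const \<alpha> * fps_X)"

lemma geom_fps_mult: "(1 + fps_const \<alpha> * fps_X) * geom_fps \<alpha> = 1"
  unfolding geom_fps_def by (rule inverse_mult_eq_1') simp

lemma geom_fps_nth: "fps_nth (geom_fps \<alpha>) n = (- \<alpha>) ^ n"
proof (induction n)
  case 0
  then show ?case by (simp add: geom_fps_def)
next
  case (Suc n)
  have "fps_nth ((1 + fps_const \<alpha> * fps_X) * geom_fps \<alpha>) (Suc n) = 0"
    by (simp add: geom_fps_mult)
  then have "fps_nth (geom_fps \<alpha>) (Suc n) + \<alpha> * fps_nth (geom_fps \<alpha>) n = 0"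
    by (simp add: distrib_right mult.assoc)
  then show ?case
    using Suc by (simp add: add_eq_0_iff)
qed

text \<open>The splitting of 1 / ((s + \<alpha>) (s + \<gamma>)) in the variable x = 1 / s, with one
  factor x cancelled on both sides.\<close>

lemma geom_fps_partial_fractions:
  assumes "\<alpha> \<noteq> \<gamma>"
  shows "fps_X * geom_fps \<alpha> * geom_fps \<gamma> = fps_const (1 / (\<gamma> - \<alpha>)) * (geom_fps \<alpha> - geom_fps \<gamma>)"
proof -
  let ?a = "1 + fps_const \<alpha> * fps_X" and ?c = "1 + fps_const \<gamma> * fps_X"
  have "geom_fps \<alpha> - geom_fps \<gamma> = (?c * geom_fps \<gamma>) * geom_fps \<alpha> - (?a * geom_fps \<alpha>) * geom_fps \<gamma>"
    by (simp only: geom_fps_mult mult_1_left)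
  also have "\<dots> = fps_const (\<gamma> - \<alpha>) * (fps_X * geom_fps \<alpha> * geom_fps \<gamma>)"
    by (simp add: algebra_simps flip: fps_const_sub)
  finally show ?thesis
    using assms by (simp flip: mult.assoc fps_const_mult)
qed

text \<open>Partial fractions expanded at s = infinity and divided by x. The power of x on the right
  is what makes the low moments of \<open>pf_coeff\<close> vanish.\<close>

lemma partial_fractions_fps:
  assumes "finite A" "A \<noteq> {}"
  shows "(\<Sum>\<alpha>\<in>A. fps_const (pf_coeff A \<alpha>) * geom_fps \<alpha>) =
    fps_X ^ (card A - 1) * (\<Prod>\<alpha>\<in>A. geom_fps \<alpha>)"
  using assms
proof (induction A rule: finite_ne_induct)
  case (singleton x)
  then show ?case by (simp add: pf_coeff_def)
next
  case (insert \<gamma> A)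
  have pg: "pf_coeff (insert \<gamma> A) \<gamma> = (\<Sum>\<alpha>\<in>A. - (pf_coeff A \<alpha> * (1 / (\<gamma> - \<alpha>))))"
  proof -
    have "\<alpha> - \<gamma> \<noteq> 0" if "\<alpha> \<in> A" for \<alpha>
      using insert.hyps that by auto
    then have "pf_coeff (insert \<gamma> A) \<gamma> = (\<Sum>\<alpha>\<in>A. pf_coeff A \<alpha> / (- \<gamma> + \<alpha>))"
      using partial_fractions[of A "- \<gamma>"] insert.hyps by (simp add: pf_coeff_def)
    then show ?thesis
      by (auto intro!: sum.cong simp: divide_simps) (simp add: algebra_simps)
  qed
  have *: "card (insert \<gamma> A) - 1 = Suc (card A - 1)"
    using insert.hyps by (simp add: card_gt_0_iff)
  have "fps_X ^ (card (insert \<gamma> A) - 1) * (\<Prod>\<alpha>\<in>insert \<gamma> A. geom_fps \<alpha>) =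
      fps_X * geom_fps \<gamma> * (fps_X ^ (card A - 1) * (\<Prod>\<alpha>\<in>A. geom_fps \<alpha>))"
    unfolding * using insert.hyps by (simp add: mult_ac)
  also have "\<dots> = (\<Sum>\<alpha>\<in>A. fps_const (pf_coeff A \<alpha>) * (fps_X * geom_fps \<alpha> * geom_fps \<gamma>))"
    by (subst insert.IH[symmetric]) (simp add: sum_distrib_left mult_ac)
  also have "\<dots> = (\<Sum>\<alpha>\<in>A. fps_const (pf_coeff A \<alpha>) *
      (fps_const (1 / (\<gamma> - \<alpha>)) * (geom_fps \<alpha> - geom_fps \<gamma>)))"
    using insert.hyps by (intro sum.cong refl arg_cong2[of _ _ _ _ "(*)"] geom_fps_partial_fractions) auto
  also have "\<dots> = (\<Sum>\<alpha>\<in>A. fps_const (pf_coeff (insert \<gamma> A) \<alpha>) * geom_fps \<alpha> +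
      fps_const (- (pf_coeff A \<alpha> * (1 / (\<gamma> - \<alpha>)))) * geom_fps \<gamma>)"
    using insert.hyps
    by (intro sum.cong refl)
      (auto simp: pf_coeff_insert right_diff_distrib simp flip: mult.assoc fps_const_neg)
  also have "\<dots> = (\<Sum>\<alpha>\<in>insert \<gamma> A. fps_const (pf_coeff (insert \<gamma> A) \<alpha>) * geom_fps \<alpha>)"
  proof -
    have "fps_const (\<Sum>\<alpha>\<in>A. f \<alpha>) = (\<Sum>\<alpha>\<in>A. fps_const (f \<alpha>))" for f :: "complex \<Rightarrow> complex"
      by (rule fps_ext) (simp add: fps_sum_nth)
    then show ?thesis
      using insert.hyps by (simp add: pg sum.distrib sum_distrib_right del: fps_const_neg)
  qed
  finally show ?case by simp
qed

text \<open>The coefficients of the product series are the complete homogeneous symmetric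
  polynomials in the numbers -\<alpha>.\<close>

lemma sum_pf_coeff_power:
  assumes "finite A" "A \<noteq> {}"
  shows "(\<Sum>\<alpha>\<in>A. pf_coeff A \<alpha> * (- \<alpha>) ^ i) =
    (if i < card A - 1 then 0 else fps_nth (\<Prod>\<alpha>\<in>A. geom_fps \<alpha>) (i - (card A - 1)))"
  using arg_cong[OF partial_fractions_fps[OF assms], of "\<lambda>F. fps_nth F i"]
  by (simp add: fps_sum_nth geom_fps_nth fps_X_power_mult_nth)

section \<open>Newton's identities by logarithmic differentiation\<close>

lemma exp_rec_eqI:
  assumes "fps_nth L 0 = 1" "fps_X * fps_deriv L = L * Q"
    and "fps_nth Q 0 = 0" "\<And>m. m \<ge> 1 \<Longrightarrow> fps_nth Q m = q m"
  shows "exp_rec q r = fps_nth L r"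
proof (induction r rule: less_induct)
  case (less r)
  show ?case
  proof (cases "r = 0")
    case True
    then show ?thesis using assms(1) by (simp add: exp_rec.simps[of q 0])
  next
    case False
    have "of_nat r * fps_nth L r = fps_nth (fps_X * fps_deriv L) r"
      using False by (cases r) auto
    also have "\<dots> = fps_nth (Q * L) r"
      by (simp add: assms(2) mult.commute)
    \<comment> \<open>The term m = 0 drops out because Q has no constant term; this leaves exactly
      the recursion of \<open>exp_rec\<close>.\<close>
    also have "\<dots> = (\<Sum>m=1..r. fps_nth Q m * fps_nth L (r - m))"
      using False assms(3) by (simp add: fps_mult_nth sum.atLeast_Suc_atMost)
    also have "\<dots> = (\<Sum>m=1..r. q m * exp_rec q (r - m))"
      using less False assms(4) by (intro sum.cong refl) auto
    finally show ?thesis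
      using False by (subst exp_rec.simps) (simp add: field_simps)
  qed
qed

text \<open>Each factor satisfies x G' = G (G - 1), so the logarithmic derivative of the product,
  times x, is the sum of the series G - 1, whose coefficients are the power sums.\<close>

lemma exp_rec_power_sums:
  assumes "finite A"
  shows "exp_rec (\<lambda>m. \<Sum>\<alpha>\<in>A. (- \<alpha>) ^ m) r = fps_nth (\<Prod>\<alpha>\<in>A. geom_fps \<alpha>) r"
proof (rule exp_rec_eqI)
  define Q where "Q = (\<Sum>\<alpha>\<in>A. geom_fps \<alpha> - 1)"
  have one: "fps_X * fps_deriv (geom_fps \<alpha>) = geom_fps \<alpha> * (geom_fps \<alpha> - 1)" for \<alpha>
  proof -
    let ?a = "1 + fps_const \<alpha> * fps_X"
    have "fps_deriv (?a * geom_fps \<alpha>) = 0"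
      by (simp add: geom_fps_mult)
    then have "?a * fps_deriv (geom_fps \<alpha>) = - fps_const \<alpha> * geom_fps \<alpha>"
      by (simp add: eq_neg_iff_add_eq_0 algebra_simps del: fps_const_neg)
    then have "geom_fps \<alpha> * (?a * fps_deriv (geom_fps \<alpha>)) = - fps_const \<alpha> * geom_fps \<alpha> * geom_fps \<alpha>"
      by simp
    moreover have "geom_fps \<alpha> * (?a * fps_deriv (geom_fps \<alpha>)) = (?a * geom_fps \<alpha>) * fps_deriv (geom_fps \<alpha>)"
      by (simp only: mult_ac)
    ultimately have d: "fps_deriv (geom_fps \<alpha>) = - fps_const \<alpha> * geom_fps \<alpha> * geom_fps \<alpha>"
      by (simp add: geom_fps_mult)
    have "geom_fps \<alpha> - 1 = geom_fps \<alpha> - ?a * geom_fps \<alpha>"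
      by (simp add: geom_fps_mult)
    also have "\<dots> = - fps_X * fps_const \<alpha> * geom_fps \<alpha>"
      by (simp add: algebra_simps)
    finally show ?thesis
      by (simp add: d mult_ac del: fps_const_neg)
  qed
  have "fps_X * fps_deriv (\<Prod>\<alpha>\<in>B. geom_fps \<alpha>) = (\<Prod>\<alpha>\<in>B. geom_fps \<alpha>) * (\<Sum>\<alpha>\<in>B. geom_fps \<alpha> - 1)"
    if "finite B" for B
    using that
  proof (induction B)
    case (insert x B)
    have "fps_X * fps_deriv (\<Prod>\<alpha>\<in>insert x B. geom_fps \<alpha>) =
        (fps_X * fps_deriv (geom_fps x)) * (\<Prod>\<alpha>\<in>B. geom_fps \<alpha>) +
        geom_fps x * (fps_X * fps_deriv (\<Prod>\<alpha>\<in>B. geom_fps \<alpha>))"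
      using insert.hyps by (simp add: algebra_simps)
    then show ?case
      unfolding one insert.IH using insert.hyps by (simp add: algebra_simps)
  qed auto
  then show "fps_X * fps_deriv (\<Prod>\<alpha>\<in>A. geom_fps \<alpha>) = (\<Prod>\<alpha>\<in>A. geom_fps \<alpha>) * Q"
    using assms by (simp add: Q_def)
  show "fps_nth (\<Prod>\<alpha>\<in>A. geom_fps \<alpha>) 0 = 1"
    using assms by (induction A) (simp_all add: geom_fps_nth)
  show "fps_nth Q 0 = 0"
    by (simp add: Q_def fps_sum_nth geom_fps_nth)
  show "fps_nth Q m = (\<Sum>\<alpha>\<in>A. (- \<alpha>) ^ m)" if "m \<ge> 1" for m
    using that by (simp add: Q_def fps_sum_nth geom_fps_nth)
qed

subsection \<open>Bernoulli--Noerlund polynomials\<close>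

definition bern_fps :: "complex fps" where
  "bern_fps = fps_X / (fps_exp 1 - 1)"

lemma bern_fps_mult: "bern_fps * (fps_exp 1 - 1) = fps_X"
proof -
  have "subdegree (fps_exp 1 - 1 :: complex fps) = 1"
    by (rule subdegreeI) auto
  then show ?thesis
    unfolding bern_fps_def by (auto intro!: dvd_div_mult_self simp: fps_dvd_iff)
qed

text \<open>For a natural exponent the binomial series is the polynomial (1 + X)^k, and substituting
  \<open>bern_fps - 1\<close>, which has no constant term, gives an ordinary power.\<close>

lemma gen_bernoulli_fps_of_nat:
  "gen_bernoulli_fps (of_nat k) x = bern_fps ^ k * fps_exp x"
proof -
  have "fps_nth (bern_fps * (fps_exp 1 - 1)) 1 = 1"
    by (simp add: bern_fps_mult)
  then have "fps_nth (bern_fps - 1) 0 = 0"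
    by (simp add: fps_mult_nth)
  then have "fps_compose ((1 + fps_X) ^ k) (bern_fps - 1) = bern_fps ^ k"
    by (simp add: fps_compose_add_distrib flip: fps_compose_power)
  then show ?thesis
    by (simp add: gen_bernoulli_fps_def fps_binomial_of_nat bern_fps_def)
qed

text \<open>Differentiate B (e^t - 1) = t and multiply by B; every exponential then occurs in the
  combination B (e^t - 1) and can be replaced by t.\<close>

lemma bern_fps_deriv: "fps_X * fps_deriv bern_fps = bern_fps * (1 - fps_X - bern_fps)"
proof -
  let ?E = "fps_exp 1 - 1 :: complex fps"
  have "fps_deriv (bern_fps * ?E) = 1"
    unfolding bern_fps_mult by simp
  then have 1: "bern_fps * (1 + ?E) + fps_deriv bern_fps * ?E = 1"
    by simp
  have "bern_fps = bern_fps * (bern_fps * (1 + ?E) + fps_deriv bern_fps * ?E)"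
    by (simp only: 1 mult_1_right)
  also have "\<dots> = bern_fps * bern_fps + bern_fps * (bern_fps * ?E) + (bern_fps * ?E) * fps_deriv bern_fps"
    by (simp add: algebra_simps)
  finally show ?thesis
    unfolding bern_fps_mult by (simp add: algebra_simps)
qed

text \<open>The logarithmic derivative of \<open>bern_fps ^ N * e^(xt)\<close> expresses coefficient \<open>N\<close> of the next
  power through coefficient \<open>N - 1\<close> of this one: the other contributions cancel exactly because the
  exponent equals the index.\<close>

lemma bern_fps_power_nth:
  "fact n * fps_nth (bern_fps ^ Suc n * fps_exp x) n = (-1) ^ n * pochhammer (1 - x) n"
proof (induction n)
  case 0
  have "fps_nth (bern_fps * (fps_exp 1 - 1)) 1 = 1"
    by (simp add: bern_fps_mult)
  then show ?case
    by (simp add: fps_mult_nth)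
next
  case (Suc n)
  let ?N = "of_nat (Suc n) :: complex"
  define f where "f = bern_fps ^ Suc n * fps_exp x"
  have "fps_X * fps_deriv f = fps_const ?N * bern_fps ^ n * (fps_X * fps_deriv bern_fps) * fps_exp x +
      fps_const x * fps_X * f"
    by (simp add: f_def fps_deriv_power algebra_simps del: power_Suc of_nat_Suc)
  also have "\<dots> = fps_const ?N * (f - fps_X * f - bern_fps * f) + fps_const x * fps_X * f"
    by (simp add: bern_fps_deriv f_def algebra_simps del: of_nat_Suc)
  finally have "fps_nth (fps_X * fps_deriv f) (Suc n) =
      fps_nth (fps_const ?N * (f - fps_X * f - bern_fps * f) + fps_const x * fps_X * f) (Suc n)"
    by simp
  then have "?N * fps_nth (bern_fps * f) (Suc n) = (x - ?N) * fps_nth f n"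
    by (simp add: mult.assoc left_diff_distrib right_diff_distrib del: of_nat_Suc)
      (simp add: algebra_simps)
  moreover have "fact (Suc n) * fps_nth (bern_fps * f) (Suc n) = fact n * (?N * fps_nth (bern_fps * f) (Suc n))"
    by (simp only: fact_Suc mult_ac)
  ultimately have "fact (Suc n) * fps_nth (bern_fps * f) (Suc n) = (x - ?N) * (fact n * fps_nth f n)"
    by simp
  also have "\<dots> = (-1) ^ Suc n * pochhammer (1 - x) (Suc n)"
    unfolding f_def Suc by (simp add: pochhammer_Suc algebra_simps)
  finally show ?case
    by (simp add: f_def mult.assoc)
qed

lemma gen_bernoulli_Suc_self:
  "gen_bernoulli (of_nat (Suc n)) n x = (-1) ^ n * pochhammer (1 - x) n"
  unfolding gen_bernoulli_def gen_bernoulli_fps_of_nat by (rule bern_fps_power_nth)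

lemma gen_bernoulli_add:
  "gen_bernoulli \<sigma> n (x + y) = (\<Sum>i=0..n. of_nat (n choose i) * gen_bernoulli \<sigma> (n - i) x * y ^ i)"
proof -
  have "gen_bernoulli_fps \<sigma> (x + y) = fps_exp y * gen_bernoulli_fps \<sigma> x"
    by (simp add: gen_bernoulli_fps_def fps_exp_add_mult mult_ac)
  then have "gen_bernoulli \<sigma> n (x + y) =
      (\<Sum>i=0..n. fact n * (y ^ i / fact i * fps_nth (gen_bernoulli_fps \<sigma> x) (n - i)))"
    by (simp add: gen_bernoulli_def fps_mult_nth sum_distrib_left)
  also have "\<dots> = (\<Sum>i=0..n. of_nat (n choose i) * gen_bernoulli \<sigma> (n - i) x * y ^ i)"
    by (intro sum.cong refl) (auto simp: gen_bernoulli_def binomial_fact)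
  finally show ?thesis .
qed

lemma bernoulli_poly_diff:
  "bernoulli_poly (Suc m) (x + 1) - bernoulli_poly (Suc m) x = of_nat (Suc m) * x ^ m"
proof -
  have g: "gen_bernoulli_fps 1 y = bern_fps * fps_exp y" for y
    using gen_bernoulli_fps_of_nat[of 1 y] by simp
  have "gen_bernoulli_fps 1 (x + 1) - gen_bernoulli_fps 1 x = fps_X * fps_exp x"
    unfolding g bern_fps_mult[symmetric] by (simp add: fps_exp_add_mult algebra_simps)
  then have "fps_nth (gen_bernoulli_fps 1 (x + 1)) (Suc m) - fps_nth (gen_bernoulli_fps 1 x) (Suc m)
      = x ^ m / fact m"
    by (simp flip: fps_sub_nth)
  then have "fact (Suc m) * (fps_nth (gen_bernoulli_fps 1 (x + 1)) (Suc m) - fps_nth (gen_bernoulli_fps 1 x) (Suc m))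
      = fact (Suc m) * (x ^ m / fact m)"
    by simp
  then show ?thesis
    by (simp add: gen_bernoulli_def right_diff_distrib)
qed

text \<open>Telescoping of \<open>bernoulli_poly_diff\<close>; it is used to turn the Bernoulli
  differences in q_m into power sums.\<close>

lemma sum_power_bernoulli:
  "of_nat (Suc m) * (\<Sum>l<k. (x + of_nat l) ^ m) =
    bernoulli_poly (Suc m) (x + of_nat k) - bernoulli_poly (Suc m) x"
proof (induction k)
  case (Suc k)
  then show ?case
    using bernoulli_poly_diff[of m "x + of_nat k"] by (simp add: algebra_simps del: of_nat_Suc) (simp add: algebra_simps)
qed auto

subsection \<open>Parameters differing by integers\<close>

text \<open>The difference series vanishes at positive reals accumulating at 0, whereas the zeros of
  a nonzero power series are isolated.\<close>

lemma powser_unique: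
  fixes d e :: "nat \<Rightarrow> complex"
  assumes "\<And>u::real. 0 < u \<Longrightarrow> u < 1 \<Longrightarrow> (\<lambda>n. d n * of_real u ^ n) sums F u"
    and "\<And>u::real. 0 < u \<Longrightarrow> u < 1 \<Longrightarrow> (\<lambda>n. e n * of_real u ^ n) sums F u"
  shows "d = e"
proof (rule ccontr)
  assume "d \<noteq> e"
  then obtain m where m: "d m \<noteq> e m" by auto
  define c where "c n = d n - e n" for n
  have c: "(\<lambda>n. c n * of_real u ^ n) sums 0" if "0 < u" "u < 1" for u :: real
    using sums_diff[OF assms[OF that]] by (simp add: c_def left_diff_distrib)
  \<comment> \<open>Multiplying the series by x makes it vanish at 0 and moves its nonzero
    coefficient to the positive index m + 1, as \<open>powser_0_nonzero\<close> requires.\<close>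
  define a where "a n = (if n = 0 then 0 else c (n - 1))" for n
  have a: "(\<lambda>n. a n * (x - 0) ^ n) sums (x * (\<Sum>n. c n * x ^ n))" if "norm (x - 0) < 1 / 2" for x
  proof -
    have "summable (\<lambda>n. c n * x ^ n)"
      by (rule powser_inside[of _ "of_real (1/2)"]) (use c[of "1/2"] that in \<open>auto simp: sums_iff\<close>)
    then have "(\<lambda>n. x * (c n * x ^ n)) sums (x * (\<Sum>n. c n * x ^ n))"
      by (intro sums_mult summable_sums)
    then have "(\<lambda>n. a (Suc n) * x ^ Suc n) sums (x * (\<Sum>n. c n * x ^ n))"
      by (simp add: a_def mult_ac)
    then show ?thesis
      using sums_Suc_iff[of "\<lambda>n. a n * x ^ n"] by (simp add: a_def)
  qed
  obtain s where s: "0 < s" "\<And>z. z \<in> cball 0 s - {0} \<Longrightarrow> z * (\<Sum>n. c n * z ^ n) \<noteq> 0"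
    by (rule powser_0_nonzero[of "1/2", OF _ a, of "Suc m"]) (use m in \<open>auto simp: a_def c_def\<close>)
  define u where "u = min s (1 / 4)"
  have "(\<Sum>n. c n * of_real u ^ n) = 0"
    using c[of u] s(1) by (simp add: u_def sums_iff)
  moreover have "complex_of_real u \<in> cball 0 s - {0}"
    using s(1) by (auto simp: u_def)
  ultimately show False
    using s(2) by fastforce
qed

section \<open>Linearity and congruence of the loop integral; existence of a loop\<close>

lemma left_loop_integral_sum:
  assumes "finite A"
    and "\<And>\<alpha> y. \<alpha> \<in> A \<Longrightarrow> y \<in> {y1, y2} \<Longrightarrow> (\<lambda>x. f \<alpha> (Complex x y)) integrable_on {..c}"
    and "\<And>\<alpha>. \<alpha> \<in> A \<Longrightarrow> f \<alpha> contour_integrable_on linepath (Complex c y1) (Complex c y2)"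
  shows "left_loop_integral c y1 y2 (\<lambda>s. \<Sum>\<alpha>\<in>A. k \<alpha> * f \<alpha> s) =
    (\<Sum>\<alpha>\<in>A. k \<alpha> * left_loop_integral c y1 y2 (f \<alpha>))"
proof -
  have "integral {..c} (\<lambda>x. \<Sum>\<alpha>\<in>A. k \<alpha> * f \<alpha> (Complex x y)) =
      (\<Sum>\<alpha>\<in>A. k \<alpha> * integral {..c} (\<lambda>x. f \<alpha> (Complex x y)))" if "y \<in> {y1, y2}" for y
    using assms(1,2) that by (simp add: integral_sum integrable_on_mult_right)
  moreover have "contour_integral (linepath (Complex c y1) (Complex c y2)) (\<lambda>s. \<Sum>\<alpha>\<in>A. k \<alpha> * f \<alpha> s) =
      (\<Sum>\<alpha>\<in>A. k \<alpha> * contour_integral (linepath (Complex c y1) (Complex c y2)) (f \<alpha>))"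
    using assms(1,3) by (simp add: contour_integral_sum contour_integral_lmul contour_integrable_lmul)
  ultimately show ?thesis
    by (simp add: left_loop_integral_def sum.distrib sum_subtractf ring_distribs)
qed

text \<open>Agreement is asked only on the lines carrying the loop, because the partial fraction
  form of the integrand is established only away from the points
  \<open>- a i - of_nat l\<close>.\<close>

lemma left_loop_integral_cong:
  assumes "\<And>x y. y \<in> {y1, y2} \<Longrightarrow> f (Complex x y) = g (Complex x y)"
    and "\<And>y. f (Complex c y) = g (Complex c y)"
  shows "left_loop_integral c y1 y2 f = left_loop_integral c y1 y2 g"
proof -
  have "contour_integral (linepath (Complex c y1) (Complex c y2)) f =
      contour_integral (linepath (Complex c y1) (Complex c y2)) g"
  proof (rule contour_integral_eq)
    fix s assume "s \<in> path_image (linepath (Complex c y1) (Complex c y2))"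
    then have "s = Complex c (Im s)"
      by (auto simp: closed_segment_same_Re complex_eq_iff)
    then show "f s = g s"
      using assms(2)[of "Im s"] by simp
  qed
  then show ?thesis
    using assms(1) by (simp add: left_loop_integral_def)
qed

text \<open>Without a loop the definite description in \<open>meijer_G\<close> would not fix a
  value. A common bound K on the moduli of the a_i suffices, since the points
  \<open>- a i - of_nat l\<close> only move left as l grows.\<close>

lemma left_loop_exists: "\<exists>c y1 y2. left_loop p a c y1 y2"
proof -
  define K where "K = (\<Sum>i=1..p. norm (a i)) + 1"
  have K: "norm (a i) < K" if "i \<in> {1..p}" for i
    using member_le_sum[of i "{1..p}" "\<lambda>i. norm (a i)"] that by (simp add: K_def)
  have "K > 0"
    unfolding K_def by (intro add_nonneg_pos sum_nonneg) auto
  then have "left_loop p a K (- K) K"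
    unfolding left_loop_def
  proof (intro conjI ballI allI)
    fix i l assume "i \<in> {1..p}"
    then have "\<bar>Re (a i)\<bar> < K" "\<bar>Im (a i)\<bar> < K"
      using K[of i] abs_Re_le_cmod[of "a i"] abs_Im_le_cmod[of "a i"] by linarith+
    then show "Re (- a i - of_nat l) < K" "- K < Im (- a i - of_nat l)" "Im (- a i - of_nat l) < K"
      by auto
  qed auto
  then show ?thesis by blast
qed

text \<open>Genericity keeps the poles belonging to different indices apart, so that all poles are
  simple. The bound is \<open>m i \<ge> 1\<close> so that raising a_k by one, from m_k \<ge> 2,
  stays inside the locale.\<close>

locale integer_shifts =
  fixes p :: nat and a b :: "nat \<Rightarrow> complex" and m :: "nat \<Rightarrow> nat"
  assumes p_pos: "p \<ge> 1"
    and m_pos: "i \<in> {1..p} \<Longrightarrow> m i \<ge> 1"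
    and b_eq: "i \<in> {1..p} \<Longrightarrow> b i = a i + of_nat (m i)"
    and generic: "i \<in> {1..p} \<Longrightarrow> j \<in> {1..p} \<Longrightarrow> i \<noteq> j \<Longrightarrow> a i - a j \<notin> \<int>"
begin

definition shifts :: "complex set" where
  "shifts = (\<Union>i\<in>{1..p}. (\<lambda>l. a i + of_nat l) ` {..<m i})"

lemma disjoint_shifts:
  assumes "i \<in> {1..p}" "j \<in> {1..p}" "i \<noteq> j"
  shows "(\<lambda>l. a i + of_nat l) ` {..<m i} \<inter> (\<lambda>l. a j + of_nat l) ` {..<m j} = {}"
proof (rule ccontr)
  assume "\<not> ?thesis"
  then obtain l l' :: nat where "a i + of_nat l = a j + of_nat l'"
    by auto
  then have "a i - a j = of_int (int l' - int l)"
    by (simp add: algebra_simps)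
  then show False
    using generic[OF assms] by simp
qed

lemma finite_shifts [simp]: "finite shifts"
  by (auto simp: shifts_def)

lemma a_in_shifts: "k \<in> {1..p} \<Longrightarrow> a k \<in> shifts"
  using m_pos[of k] by (auto simp: shifts_def intro!: bexI[of _ k] image_eqI[of _ _ 0])

lemma shifts_nonempty: "shifts \<noteq> {}"
  using p_pos a_in_shifts[of 1] by auto

lemma sum_shifts: "(\<Sum>\<alpha>\<in>shifts. f \<alpha>) = (\<Sum>i=1..p. \<Sum>l<m i. f (a i + of_nat l))"
  unfolding shifts_def using disjoint_shifts
  by (subst sum.UNION_disjoint) (auto simp: sum.reindex inj_on_def)

lemma prod_shifts: "(\<Prod>\<alpha>\<in>shifts. f \<alpha>) = (\<Prod>i=1..p. \<Prod>l<m i. f (a i + of_nat l))"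
  unfolding shifts_def using disjoint_shifts
  by (subst prod.UNION_disjoint) (auto simp: prod.reindex inj_on_def)

lemma psi_eq_card: "psi a b p = of_nat (card shifts)"
  using sum_shifts[of "\<lambda>_. 1 :: complex"] b_eq by (simp add: psi_def)

section \<open>Meijer's function and Noerlund's coefficients at integer shifts\<close>

lemma Gamma_quotient_eq:
  assumes "\<And>i l. i \<in> {1..p} \<Longrightarrow> s \<noteq> - a i - of_nat l"
  shows "(\<Prod>i=1..p. Gamma (a i + s)) / (\<Prod>i=1..p. Gamma (b i + s)) =
    (\<Sum>\<alpha>\<in>shifts. pf_coeff shifts \<alpha> / (s + \<alpha>))"
proof -
  have nonpos: "a i + s \<notin> \<int>\<^sub>\<le>\<^sub>0" if "i \<in> {1..p}" for i
  proof
    assume "a i + s \<in> \<int>\<^sub>\<le>\<^sub>0"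
    then obtain l where "a i + s = - of_nat l"
      by (auto elim!: nonpos_Ints_cases')
    then have "s = - a i - of_nat l"
      by (metis add_diff_cancel_left' minus_diff_commute)
    then show False
      using assms[OF that] by blast
  qed
  have "Gamma (b i + s) = Gamma (a i + s) * (\<Prod>l<m i. s + (a i + of_nat l))" if "i \<in> {1..p}" for i
    using pochhammer_Gamma[OF nonpos[OF that], of "m i"] nonpos[OF that] b_eq[OF that]
    by (simp add: Gamma_eq_zero_iff field_simps pochhammer_prod lessThan_atLeast0)
  then have "(\<Prod>i=1..p. Gamma (b i + s)) = (\<Prod>i=1..p. Gamma (a i + s)) * (\<Prod>\<alpha>\<in>shifts. s + \<alpha>)"
    by (simp add: prod_shifts prod.distrib)
  moreover have "(\<Prod>i=1..p. Gamma (a i + s)) \<noteq> 0"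
    using nonpos by (simp add: Gamma_eq_zero_iff)
  ultimately have "(\<Prod>i=1..p. Gamma (a i + s)) / (\<Prod>i=1..p. Gamma (b i + s)) =
      inverse (\<Prod>\<alpha>\<in>shifts. s + \<alpha>)"
    by (simp add: divide_simps)
  also have "\<dots> = (\<Sum>\<alpha>\<in>shifts. pf_coeff shifts \<alpha> / (s + \<alpha>))"
  proof (rule partial_fractions[symmetric])
    show "s + \<alpha> \<noteq> 0" if "\<alpha> \<in> shifts" for \<alpha>
    proof
      assume "s + \<alpha> = 0"
      moreover obtain i l where "i \<in> {1..p}" "\<alpha> = a i + of_nat l"
        using \<open>\<alpha> \<in> shifts\<close> by (auto simp: shifts_def)
      ultimately have "s = - a i - of_nat l"
        by (simp add: add_eq_0_iff2)
      then show False
        using assms[OF \<open>i \<in> {1..p}\<close>] by blast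
    qed
  qed (simp_all add: shifts_nonempty)
  finally show ?thesis .
qed

text \<open>Every loop encloses all the poles -\<alpha> and therefore yields the same sum of
  residues; since some loop exists, this sum is the only candidate for the definite
  description.\<close>

lemma meijer_G_eq:
  assumes z: "0 < z" "z < 1"
  shows "meijer_G p a b z = (\<Sum>\<alpha>\<in>shifts. pf_coeff shifts \<alpha> * of_real z powr \<alpha>)"
proof -
  have *: "1 / (2 * of_real pi * \<i>) * left_loop_integral c y1 y2 (meijer_integrand p a b z) =
      (\<Sum>\<alpha>\<in>shifts. pf_coeff shifts \<alpha> * of_real z powr \<alpha>)" if loop: "left_loop p a c y1 y2" for c y1 y2
  proof -
    have integrand: "meijer_integrand p a b z s =
        (\<Sum>\<alpha>\<in>shifts. pf_coeff shifts \<alpha> * pole_term z (- \<alpha>) s)"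
      if "\<And>i l. i \<in> {1..p} \<Longrightarrow> s \<noteq> - a i - of_nat l" for s
    proof -
      have "(\<Prod>i=1..p. Gamma (a i + s)) / (\<Prod>i=1..p. Gamma (b i + s)) =
          (\<Sum>\<alpha>\<in>shifts. pf_coeff shifts \<alpha> / (s + \<alpha>))"
        by (rule Gamma_quotient_eq) (use that in auto)
      then show ?thesis
        by (simp only: meijer_integrand_def sum_distrib_right) (simp add: pole_term_def)
    qed
    have pos: "Re (- \<alpha>) < c" "y1 < Im (- \<alpha>)" "Im (- \<alpha>) < y2" if "\<alpha> \<in> shifts" for \<alpha>
    proof -
      obtain i l where i: "i \<in> {1..p}" and "\<alpha> = a i + of_nat l"
        using \<open>\<alpha> \<in> shifts\<close> by (auto simp: shifts_def)
      then have "- \<alpha> = - a i - of_nat l"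
        by simp
      with i loop show "Re (- \<alpha>) < c" "y1 < Im (- \<alpha>)" "Im (- \<alpha>) < y2"
        unfolding left_loop_def by metis+
    qed
    have "left_loop_integral c y1 y2 (meijer_integrand p a b z) =
        left_loop_integral c y1 y2 (\<lambda>s. \<Sum>\<alpha>\<in>shifts. pf_coeff shifts \<alpha> * pole_term z (- \<alpha>) s)"
    proof (rule left_loop_integral_cong)
      fix x y assume "y \<in> {y1, y2}"
      then show "meijer_integrand p a b z (Complex x y) =
          (\<Sum>\<alpha>\<in>shifts. pf_coeff shifts \<alpha> * pole_term z (- \<alpha>) (Complex x y))"
        using loop by (intro integrand) (fastforce simp: left_loop_def complex_eq_iff)
    next
      fix y show "meijer_integrand p a b z (Complex c y) =
          (\<Sum>\<alpha>\<in>shifts. pf_coeff shifts \<alpha> * pole_term z (- \<alpha>) (Complex c y))"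
        using loop by (intro integrand) (fastforce simp: left_loop_def complex_eq_iff)
    qed
    also have "\<dots> = (\<Sum>\<alpha>\<in>shifts. pf_coeff shifts \<alpha> * left_loop_integral c y1 y2 (pole_term z (- \<alpha>)))"
    proof (rule left_loop_integral_sum)
      fix \<alpha> y assume "\<alpha> \<in> shifts" "y \<in> {y1, y2}"
      then show "(\<lambda>x. pole_term z (- \<alpha>) (Complex x y)) integrable_on {..c}"
        using pos[of \<alpha>] z by (intro integral_pole_term_horizontal) auto
    next
      fix \<alpha> assume "\<alpha> \<in> shifts"
      then show "pole_term z (- \<alpha>) contour_integrable_on linepath (Complex c y1) (Complex c y2)"
        using pos[of \<alpha>] z by (intro contour_integrable_pole_term) auto
    qed simp
    also have "\<dots> = (\<Sum>\<alpha>\<in>shifts. pf_coeff shifts \<alpha> * (2 * of_real pi * \<i> * of_real z powr \<alpha>))"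
      using left_loop_integral_pole_term[OF z pos] by (intro sum.cong refl) simp
    finally show ?thesis
      by (simp add: sum_distrib_left divide_simps mult_ac)
  qed
  show ?thesis
    unfolding meijer_G_def
  proof (rule the_equality)
    show "\<forall>c y1 y2. left_loop p a c y1 y2 \<longrightarrow> (\<Sum>\<alpha>\<in>shifts. pf_coeff shifts \<alpha> * of_real z powr \<alpha>) =
        1 / (2 * of_real pi * \<i>) * left_loop_integral c y1 y2 (meijer_integrand p a b z)"
      using * by simp
  next
    fix w
    assume "\<forall>c y1 y2. left_loop p a c y1 y2 \<longrightarrow>
        w = 1 / (2 * of_real pi * \<i>) * left_loop_integral c y1 y2 (meijer_integrand p a b z)"
    then show "w = (\<Sum>\<alpha>\<in>shifts. pf_coeff shifts \<alpha> * of_real z powr \<alpha>)"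
      using * left_loop_exists[of p a] by metis
  qed
qed

lemma norlund_coefficient_eq:
  assumes g: "norlund_coefficients p g" and k: "k \<in> {1..p}"
  shows "g k n a b = (\<Sum>\<alpha>\<in>shifts. pf_coeff shifts \<alpha> * pochhammer (a k - \<alpha>) (card shifts - 1 + n))"
proof -
  define M where "M = card shifts"
  have M: "M \<ge> 1"
    unfolding M_def using shifts_nonempty by (simp add: Suc_le_eq card_gt_0_iff)
  have psi: "psi a b p = of_nat M"
    by (simp add: M_def psi_eq_card)
  have notnat: "- psi a b p \<notin> \<nat>"
  proof
    assume "- psi a b p \<in> \<nat>"
    then obtain j where "- of_nat M = (of_nat j :: complex)"
      by (auto simp: psi elim: Nats_cases)
    then have "of_nat (M + j) = (0 :: complex)"
      by (metis add.right_inverse of_nat_add)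
    then show False
      using M by (simp only: of_nat_eq_0_iff)
  qed
  \<comment> \<open>Two expansions of G(z) / z^(a_k) in u = 1 - z are compared. In \<open>d\<close>,
    Noerlund's series, the factor (1 - z)^(\<psi> - 1) = u^(M - 1) shifts the index, and Gamma(M)
    (M)_n = (M - 1 + n)!. The series of \<open>e\<close> comes from expanding each (1 - u)^(\<alpha>
    - a_k) binomially.\<close>
  define d where "d N = (if N < M - 1 then 0 else g k (N - (M - 1)) a b / fact N)" for N
  define e where "e N = (\<Sum>\<alpha>\<in>shifts. pf_coeff shifts \<alpha> * pochhammer (a k - \<alpha>) N) / fact N" for N
  have "d = e"
  proof (rule powser_unique)
    fix u :: real assume u: "0 < u" "u < 1"
    define z where "z = 1 - u"
    have z: "0 < z" "z < 1" using u by (auto simp: z_def)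
    have zk: "of_real z powr a k \<noteq> (0 :: complex)" using z by simp
    define H where "H = (\<Sum>\<alpha>\<in>shifts. pf_coeff shifts \<alpha> * (1 + - of_real u) powr (\<alpha> - a k))"
    have "(\<lambda>n. of_real z powr a k * of_real (1 - z) powr (psi a b p - 1) / Gamma (psi a b p) *
                (g k n a b / pochhammer (psi a b p) n * of_real (1 - z) ^ n))
             sums meijer_G p a b z"
      using g k z notnat unfolding norlund_coefficients_def by auto
    then have "(\<lambda>n. of_real z powr a k * of_real (1 - z) powr (psi a b p - 1) / Gamma (psi a b p) *
                (g k n a b / pochhammer (psi a b p) n * of_real (1 - z) ^ n) / of_real z powr a k)
             sums (meijer_G p a b z / of_real z powr a k)"
      by (rule sums_divide)
    moreover have "meijer_G p a b z / of_real z powr a k = H"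
      unfolding meijer_G_eq[OF z] H_def
      by (simp add: sum_divide_distrib z_def powr_diff)
    moreover have "of_real z powr a k * of_real (1 - z) powr (psi a b p - 1) / Gamma (psi a b p) *
        (g k n a b / pochhammer (psi a b p) n * of_real (1 - z) ^ n) / of_real z powr a k
        = d (n + (M - 1)) * of_real u ^ (n + (M - 1))" for n
    proof -
      have G: "Gamma (psi a b p) * pochhammer (psi a b p) n = fact (n + (M - 1))"
      proof -
        have "of_nat M \<notin> (\<int>\<^sub>\<le>\<^sub>0 :: complex set)"
          using M by (auto simp: of_nat_in_nonpos_Ints_iff)
        then have "Gamma (of_nat M :: complex) * pochhammer (of_nat M) n = Gamma (of_nat M + of_nat n)"
          by (simp add: pochhammer_Gamma Gamma_eq_zero_iff)
        also have "of_nat M + of_nat n = 1 + (of_nat (n + (M - 1)) :: complex)"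
          using M by simp
        also have "Gamma \<dots> = fact (n + (M - 1))"
          by (rule Gamma_fact)
        finally show ?thesis
          by (simp add: psi)
      qed
      have "of_real (1 - z) powr (psi a b p - 1) = (of_real u :: complex) ^ (M - 1)"
        using u M powr_nat'[of "of_real u :: complex" "M - 1"] by (simp add: z_def psi of_nat_diff)
      then show ?thesis
        using zk G by (simp add: d_def z_def power_add mult_ac)
    qed
    ultimately have "(\<lambda>n. d (n + (M - 1)) * of_real u ^ (n + (M - 1))) sums H"
      by simp
    then show "(\<lambda>N. d N * of_real u ^ N) sums H"
      by (subst (asm) sums_zero_iff_shift) (auto simp: d_def)
    have "(\<lambda>N. \<Sum>\<alpha>\<in>shifts. pf_coeff shifts \<alpha> * (((\<alpha> - a k) gchoose N) * (- of_real u) ^ N)) sums H"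
      unfolding H_def using u by (intro sums_sum sums_mult gen_binomial_complex) auto
    moreover have "(\<Sum>\<alpha>\<in>shifts. pf_coeff shifts \<alpha> * (((\<alpha> - a k) gchoose N) * (- of_real u) ^ N)) =
        e N * of_real u ^ N" for N
    proof -
      have "((\<alpha> - a k) gchoose N) * (- of_real u) ^ N = pochhammer (a k - \<alpha>) N * of_real u ^ N / fact N" for \<alpha>
        by (simp add: gbinomial_pochhammer power_minus[of "of_real u"] flip: power_add mult_2)
      then show ?thesis
        by (simp add: e_def sum_divide_distrib sum_distrib_right mult.assoc)
    qed
    ultimately show "(\<lambda>N. e N * of_real u ^ N) sums H"
      by simp
  qed
  then have "d (M - 1 + n) = e (M - 1 + n)"
    by simp
  then show ?thesis
    by (simp add: d_def e_def M_def)
qed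

end

subsection \<open>Polynomials in the parameters\<close>

lemma param_polynomial_sum:
  assumes "finite A" "\<And>x. x \<in> A \<Longrightarrow> param_polynomial p (f x)"
  shows "param_polynomial p (\<lambda>a b. \<Sum>x\<in>A. f x a b)"
  using assms
proof (induction A)
  case empty
  then show ?case by (simp add: param_polynomial.const)
next
  case (insert x A)
  then show ?case by (simp add: param_polynomial.add)
qed

lemma param_polynomial_prod:
  assumes "finite A" "\<And>x. x \<in> A \<Longrightarrow> param_polynomial p (f x)"
  shows "param_polynomial p (\<lambda>a b. \<Prod>x\<in>A. f x a b)"
  using assms
proof (induction A)
  case empty
  then show ?case by (simp add: param_polynomial.const)
next
  case (insert x A)
  then show ?case by (simp add: param_polynomial.mult)
qed

lemma param_polynomial_diff:
  assumes "param_polynomial p f" "param_polynomial p g"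
  shows "param_polynomial p (\<lambda>a b. f a b - g a b)"
  using param_polynomial.add[OF assms(1) param_polynomial.mult[OF param_polynomial.const[of p "-1"] assms(2)]]
  by simp

lemma param_polynomial_divide:
  assumes "param_polynomial p f"
  shows "param_polynomial p (\<lambda>a b. f a b / c)"
  using param_polynomial.mult[OF assms param_polynomial.const[of p "inverse c"]]
  by (simp add: divide_inverse)

lemma param_polynomial_power:
  assumes "param_polynomial p f"
  shows "param_polynomial p (\<lambda>a b. f a b ^ n)"
  using param_polynomial_prod[of "{..<n}" p "\<lambda>_. f"] assms by simp

lemma param_polynomial_pochhammer:
  assumes "param_polynomial p f"
  shows "param_polynomial p (\<lambda>a b. pochhammer (f a b) n)"
  unfolding pochhammer_prod
  by (intro param_polynomial_prod param_polynomial.add assms param_polynomial.const) auto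

lemma param_polynomial_gbinomial:
  assumes "param_polynomial p f"
  shows "param_polynomial p (\<lambda>a b. f a b gchoose n)"
  unfolding gbinomial_prod_rev
  by (intro param_polynomial_divide param_polynomial_prod param_polynomial_diff assms param_polynomial.const) auto

lemma param_polynomial_psi: "param_polynomial p (\<lambda>a b. psi a b p)"
  unfolding psi_def
  by (intro param_polynomial_sum param_polynomial_diff param_polynomial.var_a param_polynomial.var_b) auto

text \<open>Each coefficient is a finite sum in which the order enters only through generalized
  binomial coefficients and the argument only through powers, so it is polynomial in both.\<close>

lemma param_polynomial_gen_bernoulli:
  assumes "param_polynomial p f" "param_polynomial p g"
  shows "param_polynomial p (\<lambda>a b. gen_bernoulli (f a b) n (g a b))"
  unfolding gen_bernoulli_def gen_bernoulli_fps_def fps_mult_nth fps_compose_nth fps_binomial_nth fps_exp_nth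
  by (intro param_polynomial.mult param_polynomial.const param_polynomial_sum param_polynomial_divide
      param_polynomial_power param_polynomial_gbinomial assms) auto

lemma param_polynomial_exp_rec:
  assumes "\<And>m. param_polynomial p (\<lambda>a b. q a b m)"
  shows "param_polynomial p (\<lambda>a b. exp_rec (q a b) r)"
proof (induction r rule: less_induct)
  case (less r)
  show ?case
  proof (cases "r = 0")
    case True
    then show ?thesis by (simp add: exp_rec.simps[of _ 0] param_polynomial.const)
  next
    case False
    have "param_polynomial p (\<lambda>a b. 1 / of_nat r * (\<Sum>m=1..r. q a b m * exp_rec (q a b) (r - m)))"
      using False
      by (intro param_polynomial.mult param_polynomial.const param_polynomial_sum assms less) auto
    then show ?thesis
      using False by (simp add: exp_rec.simps[of _ r])
  qed
qed

lemma param_polynomial_norlund_l: "param_polynomial p (\<lambda>a b. norlund_l p a b r)"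
  unfolding norlund_l_def norlund_q_def
  by (intro param_polynomial_exp_rec param_polynomial.mult param_polynomial.const
      param_polynomial_sum param_polynomial_diff param_polynomial_gen_bernoulli
      param_polynomial.var_a param_polynomial.var_b) auto

lemma param_polynomial_shift_a:
  assumes "param_polynomial p f"
  shows "param_polynomial p (\<lambda>a b. f (a(k := a k + c)) b)"
  using assms
proof (induction rule: param_polynomial.induct)
  case (var_a i)
  then show ?case
    by (cases "i = k") (auto intro!: param_polynomial.intros)
qed (auto intro: param_polynomial.intros)

section \<open>Parameter polynomials that vanish at special parameters\<close>

lemma param_polynomial_on_curve:
  assumes "param_polynomial p f"
  shows "\<exists>q. \<forall>x. f (\<lambda>i. poly (A i) x) (\<lambda>i. poly (B i) x) = poly q x"
  using assms
proof (induction rule: param_polynomial.induct)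
  case (const c)
  then show ?case by (intro exI[of _ "[:c:]"]) simp
next
  case (add f g)
  then show ?case by (metis poly_add)
next
  case (mult f g)
  then show ?case by (metis poly_mult)
qed auto

text \<open>A polynomial in one variable with infinitely many roots is zero, so vanishing at the
  points of X spreads to the whole curve.\<close>

lemma param_polynomial_curve_zero:
  assumes "param_polynomial p f" "infinite X"
    and "\<And>x. x \<in> X \<Longrightarrow> f (\<lambda>i. poly (A i) x) (\<lambda>i. poly (B i) x) = 0"
  shows "f (\<lambda>i. poly (A i) x) (\<lambda>i. poly (B i) x) = 0"
proof -
  obtain q where q: "\<And>x. f (\<lambda>i. poly (A i) x) (\<lambda>i. poly (B i) x) = poly q x"
    using param_polynomial_on_curve[OF assms(1)] by metis
  have "X \<subseteq> {x. poly q x = 0}"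
    using assms(3) by (auto simp: q)
  then have "q = 0"
    using assms(2) finite_subset poly_roots_finite by blast
  then show ?thesis
    by (simp add: q)
qed

text \<open>The coordinates of b are freed one at a time: at stage j only the b_i with i > j must
  still be admissible shifts, and the next coordinate runs along a line with infinitely many
  admissible points.\<close>

lemma param_polynomial_zero_b:
  assumes f: "param_polynomial p f"
    and zero: "\<And>b. (\<And>i. i \<in> {1..p} \<Longrightarrow> \<exists>m\<ge>2. b i = a i + of_nat m) \<Longrightarrow> f a b = 0"
  shows "f a b = 0"
proof -
  have "f a b = 0" if "j \<le> p" "\<And>i. i \<in> {j<..p} \<Longrightarrow> \<exists>m\<ge>2. b i = a i + of_nat m" for j b
    using that
  proof (induction j arbitrary: b)
    case 0
    then show ?case by (intro zero) auto
  next
    case (Suc j)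
    define B where "B i = (if i = Suc j then [:0, 1:] else [:b i:])" for i
    have B: "(\<lambda>i. poly (B i) x) = b(Suc j := x)" for x
      by (auto simp: B_def)
    have "f (\<lambda>i. poly [:a i:] (b (Suc j))) (\<lambda>i. poly (B i) (b (Suc j))) = 0"
    proof (rule param_polynomial_curve_zero[OF f])
      have "inj (\<lambda>m::nat. a (Suc j) + of_nat m)"
        by (auto intro!: injI)
      then show "infinite ((\<lambda>m::nat. a (Suc j) + of_nat m) ` {2..})"
        by (subst finite_image_iff) (auto intro: inj_on_subset simp: infinite_Ici)
    next
      fix x assume "x \<in> (\<lambda>m::nat. a (Suc j) + of_nat m) ` {2..}"
      then show "f (\<lambda>i. poly [:a i:] x) (\<lambda>i. poly (B i) x) = 0"
        unfolding B using Suc.prems by (auto intro!: Suc.IH)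
    qed
    then show ?case
      by (simp add: B)
  qed
  from this[of p b] show ?thesis by simp
qed

text \<open>Along the line \<open>a i + i * x\<close> only countably many \<open>x\<close> produce an integral difference.\<close>

lemma param_polynomial_zero:
  assumes p: "p \<ge> 1" and f: "param_polynomial p f"
    and zero: "\<And>a b m. integer_shifts p a b m \<Longrightarrow> (\<And>i. i \<in> {1..p} \<Longrightarrow> m i \<ge> 2) \<Longrightarrow> f a b = 0"
  shows "f a b = 0"
proof -
  have gen: "f a b = 0" if "\<And>i j. i \<in> {1..p} \<Longrightarrow> j \<in> {1..p} \<Longrightarrow> i \<noteq> j \<Longrightarrow> a i - a j \<notin> \<int>" for a b
  proof (rule param_polynomial_zero_b[OF f])
    fix b assume "\<And>i. i \<in> {1..p} \<Longrightarrow> \<exists>m\<ge>2. b i = a i + of_nat m"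
    then obtain m where m: "\<And>i. i \<in> {1..p} \<Longrightarrow> m i \<ge> (2::nat)"
        and b: "\<And>i. i \<in> {1..p} \<Longrightarrow> b i = a i + of_nat (m i)"
      by metis
    have "m i \<ge> 1" if "i \<in> {1..p}" for i
      using m[OF that] by simp
    then have "integer_shifts p a b m"
      by (intro integer_shifts.intro p b that)
    then show "f a b = 0"
      using m by (rule zero)
  qed
  define X where "X = {x. \<forall>i\<in>{1..p}. \<forall>j\<in>{1..p}. i \<noteq> j \<longrightarrow> (a i + of_nat i * x) - (a j + of_nat j * x) \<notin> \<int>}"
  have "- X \<subseteq> (\<Union>i\<in>{1..p}. \<Union>j\<in>{1..p}. (\<lambda>n. (n - a i + a j) / (of_nat i - of_nat j)) ` \<int>)"
  proof
    fix x assume "x \<in> - X"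
    then obtain i j where ij: "i \<in> {1..p}" "j \<in> {1..p}" "i \<noteq> j"
        and int: "(a i + of_nat i * x) - (a j + of_nat j * x) \<in> \<int>"
      by (auto simp: X_def)
    define n where "n = (a i + of_nat i * x) - (a j + of_nat j * x)"
    have "n - a i + a j = x * (of_nat i - of_nat j)"
      by (simp add: n_def algebra_simps)
    then have "x = (n - a i + a j) / (of_nat i - of_nat j)"
      using ij by simp
    then show "x \<in> (\<Union>i\<in>{1..p}. \<Union>j\<in>{1..p}. (\<lambda>n. (n - a i + a j) / (of_nat i - of_nat j)) ` \<int>)"
      using ij int unfolding n_def by blast
  qed
  moreover have "countable (\<int> :: complex set)"
    by (simp add: Ints_def)
  ultimately have "countable (- X)"
    by (auto intro: countable_subset)
  then have "infinite X"
    using uncountable_UNIV_complex countable_finite[of X] countable_Un[of X "- X"] by auto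
  \<comment> \<open>X is infinite because its complement is countable. The line passes through the
    given a at x = 0, which itself need not belong to X.\<close>
  define A where "A i = [:a i, of_nat i:]" for i
  have "f (\<lambda>i. poly (A i) 0) (\<lambda>i. poly [:b i:] 0) = 0"
  proof (rule param_polynomial_curve_zero[OF f \<open>infinite X\<close>])
    fix x assume "x \<in> X"
    then show "f (\<lambda>i. poly (A i) x) (\<lambda>i. poly [:b i:] x) = 0"
      by (intro gen) (auto simp: X_def A_def mult.commute)
  qed
  then show ?thesis
    by (simp add: A_def)
qed

subsection \<open>The two formulas\<close>

context integer_shifts
begin

lemma norlund_q_eq: "norlund_q p a b r = (\<Sum>\<alpha>\<in>shifts. (- \<alpha>) ^ r)"
proof -
  have "(\<Sum>j=1..p. bernoulli_poly (r + 1) (a j) - bernoulli_poly (r + 1) (b j)) =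
      (\<Sum>j=1..p. - of_nat (Suc r) * (\<Sum>l<m j. (a j + of_nat l) ^ r))"
    by (rule sum.cong[OF refl])
      (simp add: b_eq minus_mult_left[symmetric] sum_power_bernoulli del: of_nat_Suc)
  also have "\<dots> = - of_nat (Suc r) * (\<Sum>\<alpha>\<in>shifts. \<alpha> ^ r)"
    by (simp add: sum_shifts sum_distrib_left)
  finally have "norlund_q p a b r = (-1) ^ (r + 1) / of_nat (Suc r) *
      (- of_nat (Suc r) * (\<Sum>\<alpha>\<in>shifts. \<alpha> ^ r))"
    by (simp only: norlund_q_def Suc_eq_plus1)
  also have "\<dots> = (-1) ^ r * (\<Sum>\<alpha>\<in>shifts. \<alpha> ^ r)"
    by (simp del: of_nat_Suc)
  also have "\<dots> = (\<Sum>\<alpha>\<in>shifts. (- \<alpha>) ^ r)"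
    by (simp add: sum_distrib_left flip: power_mult_distrib)
  finally show ?thesis .
qed

lemma norlund_l_eq: "norlund_l p a b r = fps_nth (\<Prod>\<alpha>\<in>shifts. geom_fps \<alpha>) r"
proof -
  have "norlund_q p a b = (\<lambda>r. \<Sum>\<alpha>\<in>shifts. (- \<alpha>) ^ r)"
    using norlund_q_eq by auto
  then show ?thesis
    by (simp add: norlund_l_def exp_rec_power_sums)
qed

lemma norlund_coefficient_bernoulli:
  assumes g: "norlund_coefficients p g" and k: "k \<in> {1..p}"
  shows "g k n a b =
      (\<Sum>r=0..n. (-1) ^ (n - r) * pochhammer (psi a b p + of_nat r) (n - r) / fact (n - r) *
         norlund_l p a b r *
         gen_bernoulli (of_nat n + psi a b p) (n - r) (1 - a k))"
proof -
  define M where "M = card shifts"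
  have M: "M \<ge> 1"
    unfolding M_def using shifts_nonempty by (simp add: Suc_le_eq card_gt_0_iff)
  \<comment> \<open>The index of the Pochhammer symbol in \<open>norlund_coefficient_eq\<close>;
    since \<psi> = M, the order N + 1 equals n + \<psi>.\<close>
  define N where "N = M - 1 + n"
  define B where "B i = gen_bernoulli (of_nat (Suc N)) i (1 - a k)" for i
  define L where "L = (\<Prod>\<alpha>\<in>shifts. geom_fps \<alpha>)"
  have sign: "(-1) ^ N * \<alpha> ^ i = (-1) ^ (N - i) * (- \<alpha>) ^ i" if "i \<le> N" for i and \<alpha> :: complex
  proof -
    have "(-1) ^ N = (-1) ^ (N - i) * ((-1 :: complex) ^ i)"
      using that by (simp flip: power_add)
    then show ?thesis
      by (simp add: power_minus[of \<alpha>])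
  qed
  \<comment> \<open>The Pochhammer symbol is, up to sign, a Bernoulli polynomial of order N + 1 at 1
    - a_k + \<alpha>; the addition theorem separates \<alpha>, so that only moments of
    \<open>pf_coeff\<close> remain.\<close>
  have "pochhammer (a k - \<alpha>) N = (\<Sum>i=0..N. (-1) ^ (N - i) * of_nat (N choose i) * B (N - i) * (- \<alpha>) ^ i)"
    for \<alpha>
  proof -
    have "gen_bernoulli (of_nat (Suc N)) N (1 - a k + \<alpha>) = (-1) ^ N * pochhammer (a k - \<alpha>) N"
      by (subst gen_bernoulli_Suc_self) simp
    then have "pochhammer (a k - \<alpha>) N = (-1) ^ N * gen_bernoulli (of_nat (Suc N)) N (1 - a k + \<alpha>)"
      by simp
    also have "\<dots> = (\<Sum>i=0..N. of_nat (N choose i) * B (N - i) * ((-1) ^ N * \<alpha> ^ i))"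
      by (simp add: gen_bernoulli_add B_def sum_distrib_left mult_ac del: of_nat_Suc)
    also have "\<dots> = (\<Sum>i=0..N. (-1) ^ (N - i) * of_nat (N choose i) * B (N - i) * (- \<alpha>) ^ i)"
      by (intro sum.cong refl) (simp add: sign)
    finally show ?thesis .
  qed
  then have "g k n a b = (\<Sum>\<alpha>\<in>shifts. pf_coeff shifts \<alpha> *
      (\<Sum>i=0..N. (-1) ^ (N - i) * of_nat (N choose i) * B (N - i) * (- \<alpha>) ^ i))"
    using norlund_coefficient_eq[OF g k, of n] by (simp add: N_def M_def)
  also have "\<dots> = (\<Sum>i=0..N. (-1) ^ (N - i) * of_nat (N choose i) * B (N - i) *
      (\<Sum>\<alpha>\<in>shifts. pf_coeff shifts \<alpha> * (- \<alpha>) ^ i))"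
    unfolding sum_distrib_left by (subst sum.swap) (simp add: mult_ac)
  also have "\<dots> = (\<Sum>i=0..N. (-1) ^ (N - i) * of_nat (N choose i) * B (N - i) *
      (if i < M - 1 then 0 else fps_nth L (i - (M - 1))))"
    by (simp only: sum_pf_coeff_power[OF finite_shifts shifts_nonempty] L_def M_def)
  \<comment> \<open>The moments below M - 1 vanish; the bounds are written so that the substitution
    i = r + (M - 1) applies.\<close>
  also have "\<dots> = (\<Sum>i=0+(M-1)..n+(M-1). (-1) ^ (N - i) * of_nat (N choose i) * B (N - i) *
      (if i < M - 1 then 0 else fps_nth L (i - (M - 1))))"
    by (rule sum.mono_neutral_right) (auto simp: N_def)
  also have "\<dots> = (\<Sum>r=0..n. (-1) ^ (n - r) * of_nat (N choose (r + (M - 1))) * B (n - r) * fps_nth L r)"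
    unfolding sum.shift_bounds_cl_nat_ivl by (simp add: N_def)
  also have "\<dots> = (\<Sum>r=0..n. (-1) ^ (n - r) * pochhammer (psi a b p + of_nat r) (n - r) / fact (n - r) *
         norlund_l p a b r * gen_bernoulli (of_nat n + psi a b p) (n - r) (1 - a k))"
  proof (rule sum.cong[OF refl])
    fix r assume "r \<in> {0..n}"
    then have r: "r \<le> n" by simp
    \<comment> \<open>By symmetry the lower index becomes n - r, and N - (n - r) + 1 = M + r is the
      base of the required Pochhammer symbol.\<close>
    have "N choose (r + (M - 1)) = N choose (n - r)"
      using r by (subst binomial_symmetric) (auto simp: N_def)
    then have "of_nat (N choose (r + (M - 1))) = (of_nat N gchoose (n - r) :: complex)"
      by (simp add: binomial_gbinomial)
    also have "\<dots> = pochhammer (of_nat N - of_nat (n - r) + 1) (n - r) / fact (n - r)"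
      by (rule gbinomial_pochhammer')
    also have "of_nat N - of_nat (n - r) + 1 = psi a b p + of_nat r"
      using r M by (simp add: N_def psi_eq_card of_nat_diff flip: M_def)
    finally have "of_nat (N choose (r + (M - 1))) = pochhammer (psi a b p + of_nat r) (n - r) / fact (n - r)" .
    moreover have "of_nat (Suc N) = of_nat n + psi a b p"
      using M by (simp add: N_def psi_eq_card of_nat_diff flip: M_def)
    ultimately show "(-1) ^ (n - r) * of_nat (N choose (r + (M - 1))) * B (n - r) * fps_nth L r =
        (-1) ^ (n - r) * pochhammer (psi a b p + of_nat r) (n - r) / fact (n - r) *
         norlund_l p a b r * gen_bernoulli (of_nat n + psi a b p) (n - r) (1 - a k)"
      by (simp add: B_def norlund_l_eq L_def mult_ac del: of_nat_Suc)
  qed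
  finally show ?thesis .
qed

lemma norlund_coefficient_shift_a:
  assumes g: "norlund_coefficients p g" and k: "k \<in> {1..p}" and mk: "m k \<ge> 2"
  shows "g k n (a(k := a k + 1)) b = g k n a b"
proof -
  define a' where "a' = a(k := a k + 1)"
  \<comment> \<open>b_k stays fixed, so its distance from a_k drops by one.\<close>
  define m' where "m' = m(k := m k - 1)"
  interpret s: integer_shifts p a' b m'
  proof
    show "p \<ge> 1" by (rule p_pos)
  next
    fix i assume "i \<in> {1..p}"
    then show "m' i \<ge> 1" "b i = a' i + of_nat (m' i)"
      using m_pos[of i] b_eq[of i] mk by (auto simp: m'_def a'_def of_nat_diff)
  next
    fix i j assume ij: "i \<in> {1..p}" "j \<in> {1..p}" "i \<noteq> j"
    have "a i - a j = a' i - a' j - (of_bool (i = k) - of_bool (j = k))"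
      by (simp add: a'_def)
    moreover have "of_bool (i = k) - of_bool (j = k) \<in> (\<int> :: complex set)"
      by (intro Ints_diff) auto
    ultimately show "a' i - a' j \<notin> \<int>"
      using generic[OF ij] by (auto dest: Ints_diff)
  qed
  \<comment> \<open>Raising a_k removes exactly the point a_k from the set of shifts.\<close>
  have "(\<lambda>l. a k + of_nat l) ` {..<m k} = insert (a k) ((\<lambda>l. a' k + of_nat l) ` {..<m' k})"
  proof -
    have "{..<m k} = insert 0 (Suc ` {..<m' k})"
      using mk lessThan_Suc_eq_insert_0[of "m k - 1"] by (simp add: m'_def)
    then show ?thesis
      by (simp add: image_image a'_def add_ac)
  qed
  moreover have "(\<Union>i\<in>{1..p}. S i) = (\<Union>i\<in>{1..p} - {k}. S i) \<union> S k" for S :: "nat \<Rightarrow> complex set"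
    using k by auto
  moreover have "(\<Union>i\<in>{1..p} - {k}. (\<lambda>l. a i + of_nat l) ` {..<m i}) =
      (\<Union>i\<in>{1..p} - {k}. (\<lambda>l. a' i + of_nat l) ` {..<m' i})"
    by (simp add: a'_def m'_def)
  ultimately have ins: "shifts = insert (a k) s.shifts"
    unfolding shifts_def s.shifts_def by simp
  have notin: "a k \<notin> s.shifts"
  proof
    assume "a k \<in> s.shifts"
    then obtain i l where il: "i \<in> {1..p}" "a k = a' i + of_nat l"
      by (auto simp: s.shifts_def)
    show False
    proof (cases "i = k")
      case True
      then have "of_nat (Suc l) = (0 :: complex)"
        using il by (simp add: a'_def add_ac)
      then show False
        by (simp only: of_nat_eq_0_iff)
    next
      case False
      then have "a k - a i = of_nat l"
        using il by (simp add: a'_def)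
      then show False
        using generic[OF k il(1)] False by simp
    qed
  qed
  define M where "M = card s.shifts"
  have M: "M \<ge> 1" and card: "card shifts = Suc M"
    using s.shifts_nonempty notin by (auto simp: M_def ins Suc_le_eq card_gt_0_iff)
  have "g k n a b = (\<Sum>\<alpha>\<in>shifts. pf_coeff shifts \<alpha> * pochhammer (a k - \<alpha>) (M + n))"
    using norlund_coefficient_eq[OF g k, of n] by (simp add: card)
  \<comment> \<open>The summand \<alpha> = a_k contains \<open>pochhammer 0 (M + n)\<close>, which
    is 0 because M is positive.\<close>
  also have "\<dots> = (\<Sum>\<alpha>\<in>s.shifts. pf_coeff shifts \<alpha> * pochhammer (a k - \<alpha>) (M + n))"
    using M notin by (simp add: ins pochhammer_0_left)
  also have "\<dots> = (\<Sum>\<alpha>\<in>s.shifts. pf_coeff s.shifts \<alpha> * pochhammer (a' k - \<alpha>) (M - 1 + n))"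
  proof (rule sum.cong[OF refl])
    fix \<alpha> assume \<alpha>: "\<alpha> \<in> s.shifts"
    have "pochhammer (a k - \<alpha>) (M + n) = (a k - \<alpha>) * pochhammer (a' k - \<alpha>) (M - 1 + n)"
      using M pochhammer_rec[of "a k - \<alpha>" "M - 1 + n"] by (simp add: a'_def algebra_simps)
    moreover have "pf_coeff shifts \<alpha> = pf_coeff s.shifts \<alpha> / (a k - \<alpha>)"
      unfolding ins by (rule pf_coeff_insert) (use notin \<alpha> in auto)
    moreover have "a k - \<alpha> \<noteq> 0"
      using notin \<alpha> by auto
    ultimately show "pf_coeff shifts \<alpha> * pochhammer (a k - \<alpha>) (M + n) =
        pf_coeff s.shifts \<alpha> * pochhammer (a' k - \<alpha>) (M - 1 + n)"
      by simp
  qed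
  also have "\<dots> = g k n a' b"
    using s.norlund_coefficient_eq[OF g k, of n] by (simp add: M_def)
  finally show ?thesis
    by (simp add: a'_def)
qed

end

section \<open>Extension from integer shifts to all parameters\<close>

lemma norlund_coefficients_param_polynomial:
  assumes "norlund_coefficients p g" "k \<in> {1..p}"
  shows "param_polynomial p (g k n)"
  using assms by (auto simp: norlund_coefficients_def)

lemma norlund_coefficients_bernoulli:
  assumes p: "p \<ge> 1" and g: "norlund_coefficients p g" and k: "k \<in> {1..p}"
  shows "g k n a b =
      (\<Sum>r=0..n. (-1) ^ (n - r) * pochhammer (psi a b p + of_nat r) (n - r) / fact (n - r) *
         norlund_l p a b r *
         gen_bernoulli (of_nat n + psi a b p) (n - r) (1 - a k))" (is "_ = ?R a b")
proof -
  have "param_polynomial p ?R"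
    using k
    by (intro param_polynomial_sum param_polynomial.mult param_polynomial_divide
        param_polynomial.const param_polynomial_pochhammer param_polynomial.add
        param_polynomial_psi param_polynomial_norlund_l param_polynomial_gen_bernoulli
        param_polynomial_diff param_polynomial.var_a) auto
  then have "param_polynomial p (\<lambda>a b. g k n a b - ?R a b)"
    by (rule param_polynomial_diff[OF norlund_coefficients_param_polynomial[OF g k]])
  then have "g k n a b - ?R a b = 0"
  proof (rule param_polynomial_zero[OF p])
    fix a b :: "nat \<Rightarrow> complex" and m
    assume "integer_shifts p a b m"
    then interpret integer_shifts p a b m .
    show "g k n a b - ?R a b = 0"
      using norlund_coefficient_bernoulli[OF g k, of n] by simp
  qed
  then show ?thesis by simp
qed

text \<open>Invariance under a_k -> a_k + 1 extends from integer shifts to all parameters. Then, as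
  a polynomial in the k-th entry alone, the coefficient takes the same value at all points a_k + j
  and is constant.\<close>

lemma norlund_coefficients_independent_a:
  assumes p: "p \<ge> 1" and g: "norlund_coefficients p g" and k: "k \<in> {1..p}"
  shows "g k n (a(k := x)) b = g k n a b"
proof -
  note pol = norlund_coefficients_param_polynomial[OF g k, of n]
  have shift: "g k n (a(k := a k + 1)) b = g k n a b" for a b
  proof -
    have "param_polynomial p (\<lambda>a b. g k n (a(k := a k + 1)) b - g k n a b)"
      by (intro param_polynomial_diff param_polynomial_shift_a pol)
    then have "g k n (a(k := a k + 1)) b - g k n a b = 0"
    proof (rule param_polynomial_zero[OF p])
      fix a b :: "nat \<Rightarrow> complex" and m
      assume "integer_shifts p a b m" and m: "\<And>i. i \<in> {1..p} \<Longrightarrow> m i \<ge> 2"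
      then interpret integer_shifts p a b m by blast
      show "g k n (a(k := a k + 1)) b - g k n a b = 0"
        using norlund_coefficient_shift_a[OF g k, of n] m[OF k] by simp
    qed
    then show ?thesis by simp
  qed
  have shifts: "g k n (a(k := a k + of_nat j)) b = g k n a b" for j
  proof (induction j)
    case (Suc j)
    have "(a(k := a k + of_nat j))(k := (a(k := a k + of_nat j)) k + 1) = a(k := a k + of_nat (Suc j))"
      by (simp add: fun_eq_iff)
    then show ?case
      using shift[of "a(k := a k + of_nat j)" b] Suc by argo
  qed simp
  define A where "A i = (if i = k then [:0, 1:] else [:a i:])" for i
  have A: "(\<lambda>i. poly (A i) y) = a(k := y)" for y
    by (auto simp: A_def)
  \<comment> \<open>The subtracted value is frozen at a and \<open>b0\<close>, hence a constant;
    \<open>b0\<close> is later taken to be b.\<close>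
  have "param_polynomial p (\<lambda>a' b. g k n a' b - g k n a b0)" for b0
    by (intro param_polynomial_diff pol param_polynomial.const)
  then have "g k n (\<lambda>i. poly (A i) x) (\<lambda>i. poly [:b i:] x) - g k n a b = 0"
  proof (rule param_polynomial_curve_zero)
    have "inj (\<lambda>j::nat. a k + of_nat j)"
      by (auto intro!: injI)
    then show "infinite (range (\<lambda>j::nat. a k + of_nat j))"
      by (subst finite_image_iff) auto
  next
    fix y assume "y \<in> range (\<lambda>j::nat. a k + of_nat j)"
    then show "g k n (\<lambda>i. poly (A i) y) (\<lambda>i. poly [:b i:] y) - g k n a b = 0"
      unfolding A using shifts by auto
  qed
  then show ?thesis
    by (simp add: A)
qed

theorem theorem3p3:
  fixes p k n :: nat and a b :: "nat \<Rightarrow> complex"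
    and g :: "nat \<Rightarrow> nat \<Rightarrow> (nat \<Rightarrow> complex) \<Rightarrow> (nat \<Rightarrow> complex) \<Rightarrow> complex"
  assumes "p \<ge> 1"
    and "norlund_coefficients p g"
    and "k \<in> {1..p}"
  shows "g k n a b =
      (\<Sum>r=0..n. (-1) ^ (n - r) * pochhammer (of_nat r + 1) (n - r) / fact (n - r) *
         norlund_l_tilde p a b k r *
         gen_bernoulli (of_nat n + 1) (n - r) (2 - a k - psi a b p)) \<and>
     g k n a b =
      (\<Sum>r=0..n. (-1) ^ (n - r) * pochhammer (psi a b p + of_nat r) (n - r) / fact (n - r) *
         norlund_l p a b r *
         gen_bernoulli (of_nat n + psi a b p) (n - r) (1 - a k))"
proof (rule conjI)
  define a' where "a' = a(k := a k + psi a b p - 1)"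
  \<comment> \<open>Replacing \<open>a k\<close> by \<open>a k + psi - 1\<close> leaves the coefficient unchanged and makes \<open>psi\<close> equal to 1,
     so the first formula is the second one at \<open>a'\<close>.\<close>
  have sum_a': "(\<Sum>j=1..p. F (a' j) - G j) = F (a' k) - F (a k) + (\<Sum>j=1..p. F (a j) - G j)"
    for F :: "complex \<Rightarrow> complex" and G :: "nat \<Rightarrow> complex"
  proof -
    have "(\<Sum>j=1..p. F (a' j) - G j) = (F (a' k) - G k) + (\<Sum>j\<in>{1..p} - {k}. F (a j) - G j)"
      using assms(3) by (subst sum.remove[of _ k]) (auto simp: a'_def)
    moreover have "(\<Sum>j=1..p. F (a j) - G j) = (F (a k) - G k) + (\<Sum>j\<in>{1..p} - {k}. F (a j) - G j)"
      using assms(3) by (intro sum.remove) auto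
    ultimately show ?thesis by simp
  qed
  have psi: "psi a' b p = 1"
  proof -
    have "psi c b p = - (\<Sum>j=1..p. c j - b j)" for c
      by (simp add: psi_def flip: sum_negf)
    then show ?thesis
      using sum_a'[of "\<lambda>x. x" b] by (simp add: a'_def)
  qed
  \<comment> \<open>The extra Bernoulli difference in the modified q exchanges the summand of a_k
    for that of a_k + \<psi> - 1.\<close>
  have "norlund_q p a' b = norlund_q_tilde p a b k"
    using sum_a'[of "bernoulli_poly (r + 1)" "\<lambda>j. bernoulli_poly (r + 1) (b j)" for r]
    by (auto simp: norlund_q_def norlund_q_tilde_def a'_def)
  then have "norlund_l p a' b = norlund_l_tilde p a b k"
    by (simp add: norlund_l_def norlund_l_tilde_def)
  moreover have "g k n a b = g k n a' b"
    unfolding a'_def using norlund_coefficients_independent_a[OF assms] by simp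
  moreover have "1 - a' k = 2 - a k - psi a b p"
    by (simp add: a'_def)
  ultimately show "g k n a b =
      (\<Sum>r=0..n. (-1) ^ (n - r) * pochhammer (of_nat r + 1) (n - r) / fact (n - r) *
         norlund_l_tilde p a b k r *
         gen_bernoulli (of_nat n + 1) (n - r) (2 - a k - psi a b p))"
    using norlund_coefficients_bernoulli[OF assms, of n a' b] by (simp add: psi add.commute)
  show "g k n a b =
      (\<Sum>r=0..n. (-1) ^ (n - r) * pochhammer (psi a b p + of_nat r) (n - r) / fact (n - r) *
         norlund_l p a b r *
         gen_bernoulli (of_nat n + psi a b p) (n - r) (1 - a k))"
    by (rule norlund_coefficients_bernoulli[OF assms])
qed

end
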